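(* Let $\mu$ be the set function on the Borel $\sigma$-field $\mathfrak{C}$ of $\mathbf{C}$ defined by $\mu(A)=\sup\{\varphi(K): K\subset A,\ K \text{ compact}\}$. For an arbitrary finite set $\{u_1,\dots,u_p\}\subset[0,1]$, the random vector $\pi_{u_1,\dots,u_p}$ has, under $\mu$, a multivariate normal distribution with $\mathrm{cov}(\pi_{u_j},\pi_{u_r})=\min\{u_j,u_r\}$ for $1\le j,r\le p$. Consequently $\mu$ is the Wiener probability measure on $\mathfrak{C}$.
   Context: $\mathbf{C}=\mathbf{C}[0,1]$ is the space of real-valued continuous functions on $[0,1]$ vanishing at $0$, with the norm $\|x\|=\sup_{0\le t\le 1}|x(t)|$; $\mathfrak{C}$ is its Borel $\sigma$-field. For $t_1,\dots,t_k\in[0,1]$, $\pi_{t_1,\dots,t_k}:\mathbf{C}\to\mathbb{R}^k$ is $\pi_{t_1,\dots,t_k}(x)=(x(t_1),\dots,x(t_k))$, and $\mathfrak{R}^k$ is the Borel $\sigma$-field of $\mathbb{R}^k$. For $t_1,\dots,t_k\in(0,1]$, $\nu_{t_1,\dots,t_k}$ is the $k$-variate normal distribution on $\mathfrak{R}^k$ with zero means and covariance $\min\{t_j,t_r\}$ between the $j$-th and $r$-th components. $\alpha_{t_1,\dots,t_k}$ is the measure on the sub-$\sigma$-field $\pi_{t_1,\dots,t_k}^{-1}(\mathfrak{R}^k)$ given by $\alpha_{t_1,\dots,t_k}(\pi_{t_1,\dots,t_k}^{-1}(B))=\nu_{t_1,\dots,t_k}(B)$, $B\in\mathfrak{R}^k$.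 Fix a countable dense subset $T=\{t_1,t_2,\dots\}$ of $[0,1]$ consisting of distinct points of $(0,1]$. For compact $K\subset\mathbf{C}$ define $\varphi(K)=\lim_{n\to\infty}\alpha_{t_1,\dots,t_n}\big(\pi_{t_1,\dots,t_n}^{-1}\pi_{t_1,\dots,t_n}(K)\big)$ (the limit of a non-increasing sequence of nonnegative numbers). One also sets $\varphi(\mathbf{C})=1$; the supremum defining $\mu$ runs over compact sets only. The Wiener measure on $\mathfrak{C}$ is the probability measure under which every vector $\pi_{u_1,\dots,u_p}$ is (possibly degenerate) multivariate normal with zero means and covariances $\min\{u_j,u_r\}$. *)

theory Defs
  imports "HOL-Probability.Probability"
begin

(* Functions on [0,1] are encoded as functions on the reals that are 0 off [0,1], so that each
   element of C[0,1] vanishing at 0 has exactly one representative. *)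
typedef C0 =
  "{x :: real \<Rightarrow> real. continuous_on {0..1} x \<and> x 0 = 0 \<and> (\<forall>s. s \<notin> {0..1} \<longrightarrow> x s = 0)}"
  morphisms eval C0
  by (rule exI[of _ "\<lambda>_. 0"]) auto

setup_lifting type_definition_C0

instantiation C0 :: real_vector
begin

lift_definition zero_C0 :: C0 is "\<lambda>_. 0" by auto
lift_definition plus_C0 :: "C0 \<Rightarrow> C0 \<Rightarrow> C0" is "\<lambda>x y s. x s + y s"
  by (auto intro: continuous_on_add)
lift_definition minus_C0 :: "C0 \<Rightarrow> C0 \<Rightarrow> C0" is "\<lambda>x y s. x s - y s"
  by (auto intro: continuous_on_diff)
lift_definition uminus_C0 :: "C0 \<Rightarrow> C0" is "\<lambda>x s. - x s"
  by (auto intro: continuous_on_minus)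
lift_definition scaleR_C0 :: "real \<Rightarrow> C0 \<Rightarrow> C0" is "\<lambda>c x s. c * x s"
  by (auto intro: continuous_on_mult_left)

instance
  by standard (transfer; auto simp: fun_eq_iff algebra_simps)+

end

lemma eval_bdd_above: "bdd_above ((\<lambda>s. \<bar>eval x s\<bar>) ` {0..1})"
proof -
  have "continuous_on {0..1} (\<lambda>s. \<bar>eval x s\<bar>)"
    using eval[of x] by (auto intro: continuous_on_rabs)
  then have "compact ((\<lambda>s. \<bar>eval x s\<bar>) ` {0..1})"
    by (rule compact_continuous_image) auto
  then show ?thesis
    by (intro bounded_imp_bdd_above compact_imp_bounded)
qed

instantiation C0 :: real_normed_vector
begin

definition norm_C0 :: "C0 \<Rightarrow> real" where
  "norm_C0 x = (SUP s\<in>{0..1}. \<bar>eval x s\<bar>)"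
definition dist_C0 :: "C0 \<Rightarrow> C0 \<Rightarrow> real" where
  "dist_C0 x y = norm (x - y)"
definition sgn_C0 :: "C0 \<Rightarrow> C0" where
  "sgn_C0 x = x /\<^sub>R norm x"
definition uniformity_C0 :: "(C0 \<times> C0) filter" where
  "uniformity_C0 = (INF e\<in>{0<..}. principal {(x, y). dist x y < e})"
definition open_C0 :: "C0 set \<Rightarrow> bool" where
  "open_C0 U = (\<forall>x\<in>U. \<forall>\<^sub>F (x', y) in uniformity. x' = x \<longrightarrow> y \<in> U)"

instance
proof
  fix x y :: C0 and a :: real
  show "dist x y = norm (x - y)" by (rule dist_C0_def)
  show "sgn x = x /\<^sub>R norm x" by (rule sgn_C0_def)
  show "uniformity = (INF e\<in>{0<..}. principal {(x :: C0, y). dist x y < e})"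
    by (rule uniformity_C0_def)
  show "open U = (\<forall>x\<in>U. \<forall>\<^sub>F (x', y) in uniformity. x' = x \<longrightarrow> y \<in> U)" for U :: "C0 set"
    by (rule open_C0_def)
  have ub: "\<bar>eval z s\<bar> \<le> norm z" if "s \<in> {0..1}" for z s
    unfolding norm_C0_def by (rule cSUP_upper[OF that eval_bdd_above])
  have nn: "0 \<le> norm z" for z :: C0
    using ub[of 0 z] by simp
  show "(norm x = 0) = (x = 0)"
  proof
    assume "norm x = 0"
    then have "eval x s = 0" if "s \<in> {0..1}" for s
      using ub[OF that, of x] by simp
    moreover have "eval x s = 0" if "s \<notin> {0..1}" for s
      using eval[of x] that by auto
    ultimately have "eval x = (\<lambda>_. 0)" by blast
    then show "x = 0"
      by (simp add: eval_inject[symmetric] zero_C0.rep_eq)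
  next
    assume "x = 0"
    then show "norm x = 0"
      by (simp add: norm_C0_def zero_C0.rep_eq)
  qed
  show "norm (x + y) \<le> norm x + norm y"
    unfolding norm_C0_def[of "x + y"]
  proof (rule cSUP_least)
    fix s :: real assume "s \<in> {0..1}"
    then show "\<bar>eval (x + y) s\<bar> \<le> norm x + norm y"
      using ub[of s x] ub[of s y] by (simp add: plus_C0.rep_eq)
  qed simp
  have le: "norm (c *\<^sub>R z) \<le> \<bar>c\<bar> * norm z" for c and z :: C0
    unfolding norm_C0_def[of "c *\<^sub>R z"]
    by (rule cSUP_least) (auto simp: scaleR_C0.rep_eq abs_mult intro!: mult_left_mono ub)
  show "norm (a *\<^sub>R x) = \<bar>a\<bar> * norm x"
  proof (cases "a = 0")
    case True
    then show ?thesis using le[of 0 x] nn[of "a *\<^sub>R x"] by simp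
  next
    case False
    then have "norm x \<le> \<bar>inverse a\<bar> * norm (a *\<^sub>R x)"
      using le[of "inverse a" "a *\<^sub>R x"] by simp
    then have "\<bar>a\<bar> * norm x \<le> norm (a *\<^sub>R x)"
      using False by (simp add: field_simps)
    then show ?thesis using le[of a x] by linarith
  qed
qed

end

(* Vectors of length k are functions on {..<k} extended by undefined; the Borel sigma-field
   of k-dimensional space is the k-fold product of the Borel sigma-field of the line. *)
abbreviation borel_vec :: "nat \<Rightarrow> (nat \<Rightarrow> real) measure" where
  "borel_vec k \<equiv> \<Pi>\<^sub>M i\<in>{..<k}. borel"

definition \<pi> :: "nat \<Rightarrow> (nat \<Rightarrow> real) \<Rightarrow> C0 \<Rightarrow> (nat \<Rightarrow> real)" where
  "\<pi> k u x = (\<lambda>i\<in>{..<k}. eval x (u i))"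

definition normal_law :: "real \<Rightarrow> real \<Rightarrow> real measure" where
  "normal_law m \<sigma> = (if \<sigma> = 0 then return borel m else density lborel (normal_density m \<sigma>))"

definition covariance :: "'a measure \<Rightarrow> ('a \<Rightarrow> real) \<Rightarrow> ('a \<Rightarrow> real) \<Rightarrow> real" where
  "covariance M X Y =
    integral\<^sup>L M (\<lambda>w. (X w - integral\<^sup>L M X) * (Y w - integral\<^sup>L M Y))"

(* A possibly degenerate normal law: every linear combination of the coordinates is
   univariate normal, point masses included. *)
definition multivariate_normal ::
  "nat \<Rightarrow> (nat \<Rightarrow> real) \<Rightarrow> (nat \<Rightarrow> nat \<Rightarrow> real) \<Rightarrow> (nat \<Rightarrow> real) measure \<Rightarrow> bool" where
  "multivariate_normal k m \<Sigma> N \<longleftrightarrow>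
    prob_space N \<and> sets N = sets (borel_vec k) \<and>
    (\<forall>a. \<exists>c \<sigma>. 0 \<le> \<sigma> \<and> distr N borel (\<lambda>y. \<Sum>i<k. a i * y i) = normal_law c \<sigma>) \<and>
    (\<forall>i<k. integral\<^sup>L N (\<lambda>y. y i) = m i) \<and>
    (\<forall>i<k. \<forall>j<k. covariance N (\<lambda>y. y i) (\<lambda>y. y j) = \<Sigma> i j)"

definition \<nu> :: "nat \<Rightarrow> (nat \<Rightarrow> real) \<Rightarrow> (nat \<Rightarrow> real) measure" where
  "\<nu> k t = (THE N. multivariate_normal k (\<lambda>_. 0) (\<lambda>i j. min (t i) (t j)) N)"

(* The measure on the sigma-field of all \<pi> k t -` B, with B Borel, that assigns to
   \<pi> k t -` B the value of \<nu> k t at B. *)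
definition \<alpha> :: "nat \<Rightarrow> (nat \<Rightarrow> real) \<Rightarrow> C0 measure" where
  "\<alpha> k t = extend_measure UNIV (sets (borel_vec k)) (\<lambda>B. \<pi> k t -` B) (emeasure (\<nu> k t))"

definition \<phi> :: "(nat \<Rightarrow> real) \<Rightarrow> C0 set \<Rightarrow> real" where
  "\<phi> t K =
    (if K = UNIV then 1 else lim (\<lambda>n. measure (\<alpha> n t) (\<pi> n t -` (\<pi> n t ` K))))"

definition \<mu> :: "(nat \<Rightarrow> real) \<Rightarrow> C0 set \<Rightarrow> real" where
  "\<mu> t A = (SUP K\<in>{K. compact K \<and> K \<subseteq> A}. \<phi> t K)"

definition \<mu>_measure :: "(nat \<Rightarrow> real) \<Rightarrow> C0 measure" where
  "\<mu>_measure t = measure_of UNIV (sets borel) (\<lambda>A. ennreal (\<mu> t A))"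

definition brownian_marginals :: "C0 measure \<Rightarrow> bool" where
  "brownian_marginals W \<longleftrightarrow>
    (\<forall>p u. u ` {..<p} \<subseteq> {0..1} \<longrightarrow>
      multivariate_normal p (\<lambda>_. 0) (\<lambda>j r. min (u j) (u r)) (distr W (borel_vec p) (\<pi> p u)))"

definition is_wiener_measure :: "C0 measure \<Rightarrow> bool" where
  "is_wiener_measure W \<longleftrightarrow> sets W = sets borel \<and> prob_space W \<and> brownian_marginals W"

end

theory Submission
  imports Defs
begin

text \<open>A Wiener measure is constructed directly, by the Levy-Ciesielski series: independent standard
  normal coefficients times Schauder functions, whose levels have summable expected supremum norms.
  Now let \<open>W\<close> be any Wiener measure. The finite-dimensional normal laws are determined by
  their characteristic functions, so \<open>\<alpha>\<close> agrees with \<open>W\<close> on cylinders. For compact \<open>K\<close> the cylinders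
  over the projections of \<open>K\<close> decrease to \<open>K\<close>, because the times \<open>t\<close> are dense; hence \<open>\<phi> K = W K\<close>,
  and inner regularity on a Polish space gives \<open>\<mu> = W\<close> on all Borel sets.\<close>

section \<open>The space of continuous functions is Polish\<close>

text \<open>Countable additivity of \<open>\<mu>\<close> is not attacked directly, since it would
  have to be extracted from a supremum over compact sets. Moreover \<open>\<nu>\<close> is defined
  by \<open>THE\<close> and \<open>\<alpha>\<close> by \<open>extend_measure\<close>, and each has
  its intended value only when an object with the prescribed properties exists. A Wiener measure
  given beforehand settles all three points: its finite-dimensional laws witness
  \<open>\<nu>\<close>, its values on cylinders witness \<open>\<alpha>\<close>, and its additivity
  passes to \<open>\<mu>\<close>. So existence is the real task, and uniqueness follows because the
  same comparison applies to every Wiener measure. A random series that converges in norm has values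
  in the space from the start, so neither an extension theorem nor a separate argument for
  continuity of paths enters. Two facts carry it: the levels shrink geometrically in mean, and their
  covariances add up to that of a Brownian bridge, to which the linear term adds what Brownian
  motion requires.\<close>

lemma eval_le_norm: "\<bar>eval x s\<bar> \<le> norm x"
proof (cases "s \<in> {0..1}")
  case True
  then show ?thesis
    unfolding norm_C0_def by (rule cSUP_upper[OF _ eval_bdd_above])
next
  case False
  then have "eval x s = 0" using eval[of x] by auto
  then show ?thesis by simp
qed

lemma norm_C0_le: "(\<And>s. s \<in> {0..1} \<Longrightarrow> \<bar>eval x s\<bar> \<le> b) \<Longrightarrow> norm x \<le> b"
  unfolding norm_C0_def by (rule cSUP_least) auto

lemma eval_zero [simp]: "eval 0 s = 0"
  by (simp add: zero_C0.rep_eq)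

lemma eval_add [simp]: "eval (x + y) s = eval x s + eval y s"
  by (simp add: plus_C0.rep_eq)

lemma eval_diff [simp]: "eval (x - y) s = eval x s - eval y s"
  by (simp add: minus_C0.rep_eq)

lemma eval_scaleR [simp]: "eval (c *\<^sub>R x) s = c * eval x s"
  by (simp add: scaleR_C0.rep_eq)

lemma eval_sum [simp]: "eval (sum f I) s = (\<Sum>i\<in>I. eval (f i) s)"
  by (induction I rule: infinite_finite_induct) auto

lemma eval_off: "s \<notin> {0..1} \<Longrightarrow> eval x s = 0"
  using eval[of x] by auto

lemma eval_at_0 [simp]: "eval x 0 = 0"
  using eval[of x] by auto

lemma continuous_on_eval: "continuous_on {0..1} (eval x)"
  using eval[of x] by auto

lemma C0_eqI: "(\<And>s. s \<in> {0..1} \<Longrightarrow> eval x s = eval y s) \<Longrightarrow> x = y"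
  by (metis eval_inject eval_off ext)

lemma bounded_linear_eval: "bounded_linear (\<lambda>x. eval x s)"
  by (rule bounded_linear_intro[where K = 1]) (auto simp: eval_le_norm)

lemma borel_measurable_eval [measurable]: "(\<lambda>x. eval x s) \<in> borel_measurable borel"
  by (intro borel_measurable_continuous_onI linear_continuous_on bounded_linear_eval)

lemma abs_eval_diff_le_dist: "\<bar>eval x s - eval y s\<bar> \<le> dist x y"
  using eval_le_norm[of "x - y" s] by (simp add: dist_norm)

instance C0 :: banach
proof
  fix X :: "nat \<Rightarrow> C0"
  assume X: "Cauchy X"
  have "uniformly_Cauchy_on UNIV (\<lambda>n. eval (X n))"
    unfolding uniformly_Cauchy_on_def
  proof (intro allI impI)
    fix e :: real assume "e > 0"
    then obtain M where M: "\<And>m n. m \<ge> M \<Longrightarrow> n \<ge> M \<Longrightarrow> dist (X m) (X n) < e"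
      using X unfolding Cauchy_def by blast
    then show "\<exists>M. \<forall>x\<in>UNIV. \<forall>m\<ge>M. \<forall>n\<ge>M. dist (eval (X m) x) (eval (X n) x) < e"
      by (intro exI[of _ M]) (auto simp: dist_real_def intro: le_less_trans[OF abs_eval_diff_le_dist])
  qed
  then obtain l where l: "uniform_limit UNIV (\<lambda>n. eval (X n)) l sequentially"
    using Cauchy_uniformly_convergent unfolding uniformly_convergent_on_def by blast
  have lim: "(\<lambda>n. eval (X n) s) \<longlonglongrightarrow> l s" for s
    using tendsto_uniform_limitI[OF l] by simp
  have "continuous_on {0..1} l"
    by (rule uniform_limit_theorem[OF _ uniform_limit_on_subset[OF l]])
      (auto intro!: continuous_on_eval always_eventually)
  moreover have "l 0 = 0"
    using LIMSEQ_unique[OF lim[of 0]] by simp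
  moreover have "l s = 0" if "s \<notin> {0..1}" for s
    using LIMSEQ_unique[OF lim[of s]] that by (simp add: eval_off)
  ultimately have el: "eval (C0 l) = l"
    by (intro C0_inverse) auto
  have "X \<longlonglongrightarrow> C0 l"
  proof (rule metric_LIMSEQ_I)
    fix r :: real assume r: "r > 0"
    from uniform_limitD[OF l half_gt_zero[OF r]]
    obtain N where N: "\<And>n s. n \<ge> N \<Longrightarrow> dist (eval (X n) s) (l s) < r / 2"
      by (auto simp: eventually_sequentially)
    have "dist (X n) (C0 l) \<le> r / 2" if "n \<ge> N" for n
      unfolding dist_norm
      by (rule norm_C0_le) (use N[OF that] in \<open>auto simp: el dist_real_def intro: less_imp_le\<close>)
    with r show "\<exists>no. \<forall>n\<ge>no. dist (X n) (C0 l) < r"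
      by (intro exI[of _ N]) force
  qed
  then show "convergent X" by (rule convergentI)
qed

text \<open>Separability: for every rational step function and every rational tolerance, choose one
  element of the space that is uniformly close to it, if there is one. The endpoint \<open>1\<close> is left out,
  where the list index would be out of range.\<close>

lemma countable_dense_C0: "\<exists>D :: C0 set. countable D \<and> (\<forall>x e. e > 0 \<longrightarrow> (\<exists>d\<in>D. dist d x < e))"
proof -
  define near where "near = (\<lambda>(q :: rat list, m :: nat) (x :: C0).
    \<forall>s\<in>{0..1}. \<bar>eval x s - of_rat (q ! nat \<lfloor>s * real (length q)\<rfloor>)\<bar> \<le> 1 / Suc m
      \<or> s = 1)"
  define D where "D = range (\<lambda>p. SOME x. near p x)"
  have "\<exists>d\<in>D. dist d x < e" if e: "e > 0" for x e
  proof -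
    obtain m :: nat where m: "1 / Suc m < e / 4"
      using e nat_approx_posE[of "e / 4"] by auto
    have "uniformly_continuous_on {0..1} (eval x)"
      by (intro compact_uniformly_continuous continuous_on_eval) auto
    \<comment> \<open>Half of the tolerance \<open>1 / Suc m\<close> is spent on the oscillation of
      \<open>x\<close> over a step, the other half on rounding its values to rationals.\<close>
    then obtain \<delta> where \<delta>: "\<delta> > 0"
      "\<And>s s'. s \<in> {0..1} \<Longrightarrow> s' \<in> {0..1} \<Longrightarrow> dist s' s < \<delta> \<Longrightarrow> dist (eval x s') (eval x s) < 1 / (2 * Suc m)"
      unfolding uniformly_continuous_on_def by (elim allE[of _ "1 / (2 * Suc m)"]) auto
    obtain n where n: "1 / Suc n < \<delta>"
      using \<delta>(1) nat_approx_posE by blast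
    have "\<exists>q. \<bar>eval x (real i / Suc n) - of_rat q\<bar> < 1 / (2 * Suc m)" for i
    proof -
      obtain q where "eval x (real i / Suc n) < of_rat q" "of_rat q < eval x (real i / Suc n) + 1 / (2 * Suc m)"
        using of_rat_dense[of "eval x (real i / Suc n)" "eval x (real i / Suc n) + 1 / (2 * Suc m)"] by auto
      then show ?thesis by (intro exI[of _ q]) linarith
    qed
    then obtain q where q: "\<And>i. \<bar>eval x (real i / Suc n) - of_rat (q i)\<bar> < 1 / (2 * Suc m)"
      by metis
    let ?p = "(map q [0..<Suc n], m)"
    have "near ?p x"
      unfolding near_def prod.case
    proof
      fix s :: real assume s: "s \<in> {0..1}"
      show "\<bar>eval x s - of_rat (map q [0..<Suc n] ! nat \<lfloor>s * real (length (map q [0..<Suc n]))\<rfloor>)\<bar> \<le> 1 / Suc m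
        \<or> s = 1"
      proof (cases "s = 1")
        case False
        define i where "i = nat \<lfloor>s * Suc n\<rfloor>"
        have i: "real i \<le> s * Suc n" "s * Suc n < real i + 1"
          unfolding i_def using s by (auto simp: of_nat_floor)
        have "s * Suc n < Suc n" using s False by simp
        with i have "real i < Suc n" by linarith
        then have "i < Suc n" by simp
        have "dist (real i / Suc n) s < \<delta>"
        proof -
          have "0 \<le> s - real i / Suc n" "s - real i / Suc n \<le> 1 / Suc n"
            using divide_right_mono[of "real i" "s * Suc n" "Suc n"]
              divide_right_mono[of "s * Suc n" "real i + 1" "Suc n"] i
            by (auto simp: add_divide_distrib)
          with n show ?thesis by (simp add: dist_real_def)
        qed
        then have "\<bar>eval x (real i / Suc n) - eval x s\<bar> < 1 / (2 * Suc m)"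
          using \<delta>(2)[of s "real i / Suc n"] s \<open>real i < Suc n\<close> by (auto simp: dist_real_def)
        moreover have "1 / real (2 * Suc m) + 1 / real (2 * Suc m) = 1 / Suc m"
          by (simp add: field_simps)
        moreover have "\<bar>b - a\<bar> < c \<Longrightarrow> c + c = d \<Longrightarrow> \<bar>b - r\<bar> < c \<Longrightarrow> \<bar>a - r\<bar> \<le> d" for a b c d r :: real
          by linarith
        ultimately have "\<bar>eval x s - of_rat (q i)\<bar> \<le> 1 / Suc m"
          using q[of i] by blast
        then show ?thesis
          using \<open>i < Suc n\<close> unfolding i_def by (simp del: upt_Suc)
      qed simp
    qed
    define d where "d = (SOME x. near ?p x)"
    have nd: "near ?p d" unfolding d_def by (rule someI) fact
    have close: "\<bar>eval (d - x) s\<bar> \<le> 2 / Suc m" if "s \<in> {0..<1}" for s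
    proof -
      have "s \<noteq> 1" "s \<in> {0..1}" using that by auto
      then have "\<bar>eval x s - of_rat (fst ?p ! nat \<lfloor>s * real (length (fst ?p))\<rfloor>)\<bar> \<le> 1 / Suc m"
        "\<bar>eval d s - of_rat (fst ?p ! nat \<lfloor>s * real (length (fst ?p))\<rfloor>)\<bar> \<le> 1 / Suc m"
        using nd \<open>near ?p x\<close> unfolding near_def prod.case fst_conv by blast+
      then have "\<bar>eval d s - eval x s\<bar> \<le> 1 / Suc m + 1 / Suc m" by linarith
      then show ?thesis by simp
    qed
    \<comment> \<open>The endpoint 1, exempt in \<open>near\<close>, is recovered by continuity, as
      it lies in the closure of \<open>{0..<1}\<close>.\<close>
    have "\<bar>eval (d - x) s\<bar> \<le> 2 / Suc m" if "s \<in> {0..1}" for s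
    proof -
      have "s \<in> closure {0..<1}" using that by simp
      moreover have "continuous_on (closure {0..<1}) (\<lambda>s. \<bar>eval (d - x) s\<bar>)"
        using continuous_on_eval[of "d - x"] by (auto intro: continuous_on_rabs)
      ultimately show ?thesis
        using continuous_le_on_closure[of "{0..<1}" "\<lambda>s. \<bar>eval (d - x) s\<bar>" s "2 / Suc m"] close by simp
    qed
    then have "dist d x \<le> 2 / Suc m"
      unfolding dist_norm by (rule norm_C0_le)
    also have "\<dots> = 2 * (1 / Suc m)" by simp
    finally have "dist d x < e" using m e by linarith
    then show ?thesis by (auto simp: D_def d_def)
  qed
  moreover have "countable D" unfolding D_def by simp
  ultimately show ?thesis by blast
qed

instance C0 :: second_countable_topology
proof
  obtain D :: "C0 set" where D: "countable D" "\<And>x e. e > 0 \<Longrightarrow> \<exists>d\<in>D. dist d x < e"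
    using countable_dense_C0 by blast
  define B where "B = (\<lambda>(d, n). ball d (1 / Suc n)) ` (D \<times> (UNIV :: nat set))"
  have "topological_basis B"
  proof (rule topological_basisI)
    fix O' and x :: C0 assume "open O'" "x \<in> O'"
    then obtain e where e: "e > 0" "ball x e \<subseteq> O'" using open_contains_ball by blast
    obtain n where n: "1 / Suc n < e / 2" using e(1) nat_approx_posE[of "e/2"] by auto
    obtain d where d: "d \<in> D" "dist d x < 1 / Suc n" using D(2)[of "1 / Suc n" x] by auto
    have "ball d (1 / Suc n) \<subseteq> ball x e"
    proof
      fix y assume "y \<in> ball d (1 / Suc n)"
      then have "dist x y < 1 / Suc n + 1 / Suc n"
        using d(2) dist_triangle[of x y d] by (simp add: dist_commute)
      with n show "y \<in> ball x e" by simp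
    qed
    then show "\<exists>B'\<in>B. x \<in> B' \<and> B' \<subseteq> O'"
      using d e(2) by (intro bexI[of _ "ball d (1 / Suc n)"]) (auto simp: B_def)
  qed (auto simp: B_def)
  moreover have "countable B" unfolding B_def using D(1) by auto
  ultimately show "\<exists>B::C0 set set. countable B \<and> open = generate_topology B"
    using topological_basis_imp_subbasis by blast
qed

text \<open>Completeness and second countability make finite Borel measures inner regular by compact
  sets, and keep sums and series of measurable functions into the space measurable.\<close>

instance C0 :: polish_space ..

section \<open>Normal laws and characteristic functions\<close>

lemma integrable_std_normal_power: "integrable std_normal_distribution (\<lambda>x. x ^ k)"
  by (subst integrable_density) (auto simp: integrable_std_normal_moment normal_density_nonneg)

lemma integral_std_normal:
  "integral\<^sup>L std_normal_distribution (\<lambda>x. x) = 0"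
  "integral\<^sup>L std_normal_distribution (\<lambda>x. x\<^sup>2) = 1"
  "integral\<^sup>L std_normal_distribution (\<lambda>x. x ^ 4) = 3"
proof -
  have eq: "integral\<^sup>L std_normal_distribution (\<lambda>x. x ^ k) = integral\<^sup>L lborel (\<lambda>x. std_normal_density x * x ^ k)" for k
    by (subst integral_density) (auto simp: normal_density_nonneg)
  show "integral\<^sup>L std_normal_distribution (\<lambda>x. x) = 0"
    using eq[of 1] integral_std_normal_moment_odd[of 0] by simp
  show "integral\<^sup>L std_normal_distribution (\<lambda>x. x\<^sup>2) = 1"
    using eq[of 2] integral_std_normal_moment_even[of 1] by simp
  show "integral\<^sup>L std_normal_distribution (\<lambda>x. x ^ 4) = 3"
    using eq[of 4] integral_std_normal_moment_even[of 2] by (simp add: fact_numeral)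
qed

text \<open>An affine image of the standard normal law covers the point mass at \<sigma> = 0 as
  well, so characteristic functions and moments need no case distinction afterwards.\<close>

lemma normal_law_eq_distr:
  assumes "0 \<le> \<sigma>"
  shows "normal_law m \<sigma> = distr std_normal_distribution borel (\<lambda>x. m + \<sigma> * x)"
proof -
  interpret real_distribution std_normal_distribution
    by (rule real_dist_normal_dist)
  show ?thesis
  proof (cases "\<sigma> = 0")
    case True
    then show ?thesis by (simp add: normal_law_def distr_const)
  next
    case False
    have "distributed std_normal_distribution lborel (\<lambda>x. x) std_normal_density"
      unfolding distributed_def by (auto simp: distr_id2)
    then have "distributed std_normal_distribution lborel (\<lambda>x. m + \<sigma> * x) (normal_density (m + \<sigma> * 0) (\<bar>\<sigma>\<bar> * 1))"
      using False by (intro normal_density_affine) auto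
    then have "distr std_normal_distribution lborel (\<lambda>x. m + \<sigma> * x) = normal_law m \<sigma>"
      using False assms by (simp add: normal_law_def distributed_distr_eq_density)
    then show ?thesis by (simp cong: distr_cong)
  qed
qed

lemma char_normal_law:
  assumes "0 \<le> \<sigma>"
  shows "char (normal_law 0 \<sigma>) \<theta> = of_real (exp (- (\<sigma>\<^sup>2 * \<theta>\<^sup>2) / 2))"
proof -
  have "char (normal_law 0 \<sigma>) \<theta> = (CLINT x|std_normal_distribution. iexp (\<theta> * (\<sigma> * x)))"
    unfolding normal_law_eq_distr[OF assms] char_def by (subst integral_distr) auto
  also have "\<dots> = char std_normal_distribution (\<theta> * \<sigma>)"
    unfolding char_def by (simp add: mult.assoc)
  finally show ?thesis
    by (simp add: char_std_normal_distribution power_mult_distrib mult.commute)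
qed

lemma normal_law_moments:
  assumes Y: "Y \<in> borel_measurable M" and d: "distr M borel Y = normal_law c \<sigma>" and "0 \<le> \<sigma>"
  shows "integrable M Y" "integral\<^sup>L M Y = c" "integrable M (\<lambda>w. (Y w)\<^sup>2)"
    "integral\<^sup>L M (\<lambda>w. (Y w)\<^sup>2) = c\<^sup>2 + \<sigma>\<^sup>2"
proof -
  interpret real_distribution std_normal_distribution
    by (rule real_dist_normal_dist)
  note d = d[unfolded normal_law_eq_distr[OF \<open>0 \<le> \<sigma>\<close>]]
  have i: "integrable std_normal_distribution (\<lambda>x. x)" "integrable std_normal_distribution (\<lambda>x. x\<^sup>2)"
    using integrable_std_normal_power[of 1] integrable_std_normal_power[of 2] by auto
  have e: "(c + \<sigma> * x)\<^sup>2 = c\<^sup>2 + 2 * c * \<sigma> * x + \<sigma>\<^sup>2 * x\<^sup>2" for x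
    by (simp add: power2_eq_square algebra_simps)
  have transfer_int: "integrable M (\<lambda>w. f (Y w)) \<longleftrightarrow> integrable std_normal_distribution (\<lambda>x. f (c + \<sigma> * x))"
    if "f \<in> borel_measurable borel" for f :: "real \<Rightarrow> real"
    using integrable_distr_eq[OF Y that] unfolding d by (simp add: integrable_distr_eq that)
  have transfer_eq: "integral\<^sup>L M (\<lambda>w. f (Y w)) = integral\<^sup>L std_normal_distribution (\<lambda>x. f (c + \<sigma> * x))"
    if "f \<in> borel_measurable borel" for f :: "real \<Rightarrow> real"
    using integral_distr[OF Y that] unfolding d by (simp add: integral_distr that)
  have meas: "(\<lambda>y::real. y) \<in> borel_measurable borel" "(\<lambda>y::real. y\<^sup>2) \<in> borel_measurable borel"
    by measurable
  have "integrable std_normal_distribution (\<lambda>x. c + \<sigma> * x)"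
    by (intro Bochner_Integration.integrable_add integrable_const integrable_mult_right i)
  then show "integrable M Y"
    by (rule iffD2[OF transfer_int[OF meas(1)]])
  have "integral\<^sup>L std_normal_distribution (\<lambda>x. c + \<sigma> * x)
    = integral\<^sup>L std_normal_distribution (\<lambda>x. c) + integral\<^sup>L std_normal_distribution (\<lambda>x. \<sigma> * x)"
    by (intro Bochner_Integration.integral_add integrable_const integrable_mult_right i)
  also have "\<dots> = c"
    unfolding integral_mult_right_zero integral_std_normal using prob_space by simp
  finally show "integral\<^sup>L M Y = c"
    by (rule trans[OF transfer_eq[OF meas(1)]])
  have "integrable std_normal_distribution (\<lambda>x. (c + \<sigma> * x)\<^sup>2)"
    unfolding e by (intro Bochner_Integration.integrable_add integrable_const integrable_mult_right i)
  then show "integrable M (\<lambda>w. (Y w)\<^sup>2)"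
    by (rule iffD2[OF transfer_int[OF meas(2)]])
  have "integral\<^sup>L std_normal_distribution (\<lambda>x. (c + \<sigma> * x)\<^sup>2)
    = integral\<^sup>L std_normal_distribution (\<lambda>x. c\<^sup>2) + integral\<^sup>L std_normal_distribution (\<lambda>x. 2 * c * \<sigma> * x)
      + integral\<^sup>L std_normal_distribution (\<lambda>x. \<sigma>\<^sup>2 * x\<^sup>2)"
    unfolding e
    by (subst Bochner_Integration.integral_add | intro refl Bochner_Integration.integrable_add integrable_const integrable_mult_right i)+
  also have "\<dots> = c\<^sup>2 + \<sigma>\<^sup>2"
    unfolding integral_mult_right_zero integral_std_normal using prob_space by simp
  finally show "integral\<^sup>L M (\<lambda>w. (Y w)\<^sup>2) = c\<^sup>2 + \<sigma>\<^sup>2"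
    by (rule trans[OF transfer_eq[OF meas(2)]])
qed

lemma real_distribution_normal_law: "0 \<le> \<sigma> \<Longrightarrow> real_distribution (normal_law m \<sigma>)"
  unfolding normal_law_eq_distr
  by (rule prob_space.real_distribution_distr) (auto intro!: prob_space_normal_density)

section \<open>Gaussian vectors through the variances of their linear combinations\<close>

definition quad_form :: "nat \<Rightarrow> (nat \<Rightarrow> nat \<Rightarrow> real) \<Rightarrow> (nat \<Rightarrow> real) \<Rightarrow> real" where
  "quad_form k \<Sigma> a = (\<Sum>i<k. \<Sum>j<k. a i * a j * \<Sigma> i j)"

lemma quad_form_scale: "quad_form k \<Sigma> (\<lambda>i. c * a i) = c\<^sup>2 * quad_form k \<Sigma> a"
  by (simp add: quad_form_def sum_distrib_left power2_eq_square algebra_simps)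

lemma quad_form_delta:
  "i < k \<Longrightarrow> quad_form k \<Sigma> (\<lambda>l. if l = i then 1 else 0) = \<Sigma> i i"
  by (simp add: quad_form_def if_distrib[where f = "\<lambda>x. x * _"] if_distrib[where f = "\<lambda>x. _ * x"]
      sum.delta cong: if_cong)

text \<open>Meant for polarization: together with the diagonal entries this value determines
  \<open>\<Sigma> i j\<close>. Adding two \<open>of_bool\<close> terms gives the coefficient 2 when
  \<open>i = j\<close>, so the formula covers that case too.\<close>

lemma quad_form_delta2:
  assumes "i < k" "j < k" "\<Sigma> i j = \<Sigma> j i"
  shows "quad_form k \<Sigma> (\<lambda>l. of_bool (l = i) + of_bool (l = j)) = \<Sigma> i i + 2 * \<Sigma> i j + \<Sigma> j j"
proof -
  have "quad_form k \<Sigma> (\<lambda>l. of_bool (l = i) + of_bool (l = j)) =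
    (\<Sum>l<k. \<Sum>r<k. (if l = i then if r = i then \<Sigma> l r else 0 else 0) + (if l = i then if r = j then \<Sigma> l r else 0 else 0)
      + (if l = j then if r = i then \<Sigma> l r else 0 else 0) + (if l = j then if r = j then \<Sigma> l r else 0 else 0))"
    unfolding quad_form_def by (intro sum.cong) (auto simp: algebra_simps)
  also have "\<dots> = \<Sigma> i i + \<Sigma> i j + \<Sigma> j i + \<Sigma> j j"
  proof -
    have *: "(\<Sum>l<k. \<Sum>r<k. if l = p then if r = q then \<Sigma> l r else 0 else 0) = \<Sigma> p q" if "p < k" "q < k" for p q
    proof -
      have "(\<Sum>l<k. \<Sum>r<k. if l = p then if r = q then \<Sigma> l r else 0 else 0) = (\<Sum>l<k. if l = p then \<Sigma> l q else 0)"
        using that by (intro sum.cong) (auto simp: sum.delta)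
      with that show ?thesis by (simp add: sum.delta)
    qed
    show ?thesis by (simp only: sum.distrib * assms)
  qed
  finally show ?thesis using assms by simp
qed

text \<open>The definition leaves the parameters of the law of a linear combination open. Unit
  coefficient vectors show that each coordinate is normal, hence square integrable; then
  \<open>c\<close> and the square of \<sigma> are computed from the given means and covariances by
  expanding the square.\<close>

lemma char_linear_multivariate_normal:
  assumes "multivariate_normal k (\<lambda>_. 0) \<Sigma> N"
  shows "(CLINT y|N. iexp (\<Sum>i<k. a i * y i)) = of_real (exp (- quad_form k \<Sigma> a / 2))"
proof -
  have N: "prob_space N" and sets [measurable_cong]: "sets N = sets (borel_vec k)"
    and law: "\<And>a. \<exists>c \<sigma>. 0 \<le> \<sigma> \<and> distr N borel (\<lambda>y. \<Sum>i<k. a i * y i) = normal_law c \<sigma>"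
    and mean: "\<And>i. i < k \<Longrightarrow> integral\<^sup>L N (\<lambda>y. y i) = 0"
    and cov: "\<And>i j. i < k \<Longrightarrow> j < k \<Longrightarrow> covariance N (\<lambda>y. y i) (\<lambda>y. y j) = \<Sigma> i j"
    using assms by (auto simp: multivariate_normal_def)
  interpret prob_space N by fact
  have [measurable]: "(\<lambda>y. \<Sum>i<k. a i * y i) \<in> borel_measurable N" for a :: "nat \<Rightarrow> real"
    by measurable
  have coord [measurable]: "(\<lambda>y. y i) \<in> borel_measurable N" if "i < k" for i
    using that by (auto intro!: measurable_component_singleton simp: measurable_cong_sets[OF sets refl])
  have int: "integrable N (\<lambda>y. y i)" "integrable N (\<lambda>y. (y i)\<^sup>2)" if "i < k" for i
  proof -
    have "(\<Sum>l<k. (if l = i then 1 else 0) * y l) = y i" for y :: "nat \<Rightarrow> real"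
      using that by (simp add: if_distrib[where f = "\<lambda>x. x * _"] sum.delta cong: if_cong)
    then obtain c \<sigma> where "0 \<le> \<sigma>" "distr N borel (\<lambda>y. y i) = normal_law c \<sigma>"
      using law[of "\<lambda>l. if l = i then 1 else 0"] by auto
    then show "integrable N (\<lambda>y. y i)" "integrable N (\<lambda>y. (y i)\<^sup>2)"
      using normal_law_moments[OF coord[OF that]] by auto
  qed
  have int2: "integrable N (\<lambda>y. y i * y j)" if "i < k" "j < k" for i j
  proof (rule Bochner_Integration.integrable_bound)
    show "integrable N (\<lambda>y. (y i)\<^sup>2 + (y j)\<^sup>2)" using int that by auto
    have "\<bar>u * v\<bar> \<le> u\<^sup>2 + v\<^sup>2" for u v :: real
      using sum_squares_bound[of "\<bar>u\<bar>" "\<bar>v\<bar>"] abs_ge_zero[of "u * v"]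
      unfolding abs_mult power2_abs by linarith
    then show "AE y in N. norm (y i * y j) \<le> norm ((y i)\<^sup>2 + (y j)\<^sup>2)"
      by simp
  qed (use that in measurable)
  obtain c \<sigma> where \<sigma>: "0 \<le> \<sigma>" and d: "distr N borel (\<lambda>y. \<Sum>i<k. a i * y i) = normal_law c \<sigma>"
    using law by blast
  have "c = (\<integral>y. (\<Sum>i<k. a i * y i) \<partial>N)"
    using normal_law_moments(2)[OF _ d \<sigma>] by simp
  also have "\<dots> = 0" using int mean by simp
  finally have c: "c = 0" .
  have "\<sigma>\<^sup>2 = (\<integral>y. (\<Sum>i<k. a i * y i)\<^sup>2 \<partial>N)"
    using normal_law_moments(4)[OF _ d \<sigma>] c by simp
  also have "\<dots> = (\<integral>y. (\<Sum>i<k. \<Sum>j<k. a i * a j * (y i * y j)) \<partial>N)"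
    by (simp add: power2_eq_square sum_product algebra_simps)
  also have "\<dots> = (\<Sum>i<k. \<integral>y. (\<Sum>j<k. a i * a j * (y i * y j)) \<partial>N)"
    by (intro Bochner_Integration.integral_sum Bochner_Integration.integrable_sum integrable_mult_right int2) auto
  also have "\<dots> = (\<Sum>i<k. \<Sum>j<k. \<integral>y. a i * a j * (y i * y j) \<partial>N)"
    by (intro sum.cong refl Bochner_Integration.integral_sum integrable_mult_right int2) auto
  also have "\<dots> = (\<Sum>i<k. \<Sum>j<k. a i * a j * (\<integral>y. y i * y j \<partial>N))"
    by (intro sum.cong refl integral_mult_right_zero)
  also have "\<dots> = quad_form k \<Sigma> a"
    unfolding quad_form_def using cov mean by (intro sum.cong refl) (simp add: covariance_def)
  finally have s: "\<sigma>\<^sup>2 = quad_form k \<Sigma> a" .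
  have "(CLINT y|N. iexp (\<Sum>i<k. a i * y i)) = char (normal_law 0 \<sigma>) 1"
    unfolding d[unfolded c, symmetric] char_def by (subst integral_distr) auto
  then show ?thesis using \<sigma> s by (simp add: char_normal_law)
qed

text \<open>Scaling the coefficients by \<theta> turns \<open>ch\<close> into the full
  characteristic function of each linear combination, so Levy uniqueness identifies its law. Means
  and variances are read off from it, covariances by polarization.\<close>

lemma multivariate_normalI:
  assumes N: "prob_space N" and sets [measurable_cong]: "sets N = sets (borel_vec k)"
    and sym: "\<And>i j. i < k \<Longrightarrow> j < k \<Longrightarrow> \<Sigma> i j = \<Sigma> j i"
    and ch: "\<And>a. (CLINT y|N. iexp (\<Sum>i<k. a i * y i)) = of_real (exp (- quad_form k \<Sigma> a / 2))"
  shows "multivariate_normal k (\<lambda>_. 0) \<Sigma> N"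
proof -
  interpret prob_space N by fact
  have [measurable]: "(\<lambda>y. \<Sum>i<k. a i * y i) \<in> borel_measurable N" for a :: "nat \<Rightarrow> real"
    by measurable
  have coord [measurable]: "(\<lambda>y. y i) \<in> borel_measurable N" if "i < k" for i
    using that by (auto intro!: measurable_component_singleton simp: measurable_cong_sets[OF sets refl])
  \<comment> \<open>A characteristic function has modulus at most 1, which forces the exponent to be
    nonpositive.\<close>
  have nonneg: "0 \<le> quad_form k \<Sigma> a" for a
  proof -
    interpret D: real_distribution "distr N borel (\<lambda>y. \<Sum>i<k. a i * y i)"
      by (rule real_distribution_distr) measurable
    have "char (distr N borel (\<lambda>y. \<Sum>i<k. a i * y i)) 1 = of_real (exp (- quad_form k \<Sigma> a / 2))"
      unfolding char_def ch[symmetric] by (subst integral_distr) auto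
    then have "exp (- quad_form k \<Sigma> a / 2) \<le> 1"
      using D.cmod_char_le_1[of 1] by simp
    then show ?thesis by simp
  qed
  have law: "distr N borel (\<lambda>y. \<Sum>i<k. a i * y i) = normal_law 0 (sqrt (quad_form k \<Sigma> a))" for a
  proof (rule Levy_uniqueness)
    show "real_distribution (distr N borel (\<lambda>y. \<Sum>i<k. a i * y i))"
      by (rule real_distribution_distr) measurable
    show "real_distribution (normal_law 0 (sqrt (quad_form k \<Sigma> a)))"
      using nonneg by (intro real_distribution_normal_law) simp
    show "char (distr N borel (\<lambda>y. \<Sum>i<k. a i * y i)) = char (normal_law 0 (sqrt (quad_form k \<Sigma> a)))"
    proof
      fix \<theta>
      have "char (distr N borel (\<lambda>y. \<Sum>i<k. a i * y i)) \<theta> = (CLINT y|N. iexp (\<Sum>i<k. (\<theta> * a i) * y i))"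
        unfolding char_def by (subst integral_distr) (auto simp: sum_distrib_left mult.assoc)
      then show "char (distr N borel (\<lambda>y. \<Sum>i<k. a i * y i)) \<theta> = char (normal_law 0 (sqrt (quad_form k \<Sigma> a))) \<theta>"
        unfolding ch quad_form_scale using nonneg by (simp add: char_normal_law mult.commute)
    qed
  qed
  have sq: "integral\<^sup>L N (\<lambda>y. (\<Sum>i<k. a i * y i)\<^sup>2) = quad_form k \<Sigma> a" for a
    using normal_law_moments(4)[OF _ law[of a]] nonneg by simp
  have int_sq: "integrable N (\<lambda>y. (\<Sum>i<k. a i * y i)\<^sup>2)" for a
    using normal_law_moments(3)[OF _ law[of a]] nonneg by simp
  have diag: "0 \<le> \<Sigma> i i" if "i < k" for i
    using nonneg[of "\<lambda>l. if l = i then 1 else 0"] that by (simp add: quad_form_delta)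
  have one: "(\<Sum>l<k. (if l = i then 1 else 0) * y l) = y i" if "i < k" for i and y :: "nat \<Rightarrow> real"
    using that by (simp add: if_distrib[where f = "\<lambda>x. x * _"] sum.delta cong: if_cong)
  have two: "(\<Sum>l<k. (of_bool (l = i) + of_bool (l = j)) * y l) = y i + y j"
    if "i < k" "j < k" for i j and y :: "nat \<Rightarrow> real"
    using one[OF that(1), of y] one[OF that(2), of y]
    by (simp add: distrib_right sum.distrib of_bool_def)
  have law1: "distr N borel (\<lambda>y. y i) = normal_law 0 (sqrt (quad_form k \<Sigma> (\<lambda>l. if l = i then 1 else 0)))" if "i < k" for i
    using law[of "\<lambda>l. if l = i then 1 else 0"] one[OF that] by simp
  note mom = normal_law_moments[OF coord law1]
  have mean: "integral\<^sup>L N (\<lambda>y. y i) = 0" if "i < k" for i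
    using mom that nonneg by simp
  have cov: "covariance N (\<lambda>y. y i) (\<lambda>y. y j) = \<Sigma> i j" if "i < k" "j < k" for i j
  proof -
    have "\<Sigma> i i + 2 * \<Sigma> i j + \<Sigma> j j = integral\<^sup>L N (\<lambda>y. (y i + y j)\<^sup>2)"
      using sq[of "\<lambda>l. of_bool (l = i) + of_bool (l = j)"] that two[OF that] quad_form_delta2[of i k j \<Sigma>] sym by simp
    moreover have "\<Sigma> i i = integral\<^sup>L N (\<lambda>y. (y i)\<^sup>2)" "\<Sigma> j j = integral\<^sup>L N (\<lambda>y. (y j)\<^sup>2)"
      using mom(4)[OF that(1) that(1)] mom(4)[OF that(2) that(2)] diag that by (auto simp: quad_form_delta)
    moreover have int: "integrable N (\<lambda>y. (y i + y j)\<^sup>2)"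
      using int_sq[of "\<lambda>l. of_bool (l = i) + of_bool (l = j)"] unfolding two[OF that] .
    moreover have "integral\<^sup>L N (\<lambda>y. y i * y j) = integral\<^sup>L N (\<lambda>y. ((y i + y j)\<^sup>2 - (y i)\<^sup>2 - (y j)\<^sup>2) / 2)"
      by (rule Bochner_Integration.integral_cong) (auto simp: power2_eq_square algebra_simps)
    moreover have "integrable N (\<lambda>y. (y i)\<^sup>2)" "integrable N (\<lambda>y. (y j)\<^sup>2)"
      using mom(3)[OF that(1) that(1)] mom(3)[OF that(2) that(2)] nonneg by auto
    ultimately show ?thesis using mean[OF that(1)] mean[OF that(2)] by (simp add: covariance_def)
  qed
  show ?thesis
    unfolding multivariate_normal_def
  proof (intro conjI allI impI)
    fix a
    show "\<exists>c \<sigma>. 0 \<le> \<sigma> \<and> distr N borel (\<lambda>y. \<Sum>i<k. a i * y i) = normal_law c \<sigma>"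
      using law[of a] nonneg[of a] by (intro exI[of _ 0] exI[of _ "sqrt (quad_form k \<Sigma> a)"]) simp
  qed (use N sets mean cov in auto)
qed

section \<open>Multivariate characteristic functions determine the law\<close>

text \<open>The weight \<open>2 + f\<close> turns the real weight \<open>f\<close> into a positive density, to which the
  one-dimensional uniqueness theorem applies.\<close>

lemma weighted_char_unique:
  fixes f Y :: "'a \<Rightarrow> real"
  assumes "prob_space P" "prob_space Q" and sets: "sets Q = sets P"
    and [measurable]: "f \<in> borel_measurable P" "Y \<in> borel_measurable P"
    and bound: "\<And>x. \<bar>f x\<bar> \<le> 1"
    and char1: "\<And>s. (CLINT x|P. iexp (s * Y x)) = (CLINT x|Q. iexp (s * Y x))"
    and charf: "\<And>s. (CLINT x|P. f x * iexp (s * Y x)) = (CLINT x|Q. f x * iexp (s * Y x))"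
    and [measurable]: "B \<in> sets borel"
  shows "(LINT x|P. f x * indicator B (Y x)) = (LINT x|Q. f x * indicator B (Y x))"
proof -
  have [measurable_cong]: "sets Q = sets P" by (rule sets)
  \<comment> \<open>The normalizing constant. Both measures give the same value, by
    \<open>charf\<close> at \<open>s = 0\<close>, and it is at least 1 because \<open>2 + f\<close>
    is.\<close>
  define m where "m = (LINT x|P. 2 + f x)"
  define D where "D M = distr (density M (\<lambda>x. ennreal ((2 + f x) / m))) borel Y" for M :: "'a measure"
  have int: "integrable M f" "integrable M (\<lambda>x. f x * indicator B (Y x))"
    "integrable M (\<lambda>x. indicator B (Y x) :: real)"
    "integrable M (\<lambda>x. iexp (s * Y x))" "integrable M (\<lambda>x. f x * iexp (s * Y x))"
    if "M = P \<or> M = Q" for M s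
  proof -
    interpret prob_space M using assms(1,2) that by auto
    have [measurable_cong]: "sets M = sets P" using that sets by auto
    show "integrable M f" "integrable M (\<lambda>x. f x * indicator B (Y x))"
      "integrable M (\<lambda>x. indicator B (Y x) :: real)"
      "integrable M (\<lambda>x. iexp (s * Y x))" "integrable M (\<lambda>x. f x * iexp (s * Y x))"
      using bound
      by (auto intro!: integrable_const_bound[where B = 1] simp: norm_mult split: split_indicator)
  qed
  have int_f: "(LINT x|P. f x) = (LINT x|Q. f x)"
  proof -
    have "complex_of_real (LINT x|P. f x) = complex_of_real (LINT x|Q. f x)"
      using charf[of 0] by simp
    then show ?thesis by (simp only: of_real_eq_iff)
  qed
  have m: "m = 2 + (LINT x|M. f x)" "1 \<le> m" if "M = P \<or> M = Q" for M
  proof -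
    have "prob_space M" using assms(1,2) that by auto
    then interpret prob_space M .
    interpret P: prob_space P by fact
    have "m = 2 + (LINT x|P. f x)"
      unfolding m_def using int(1)[of P] by (simp add: P.prob_space)
    then show *: "m = 2 + (LINT x|M. f x)" using int_f that by auto
    have "\<bar>LINT x|M. f x\<bar> \<le> (LINT x|M. 1)"
      by (rule order_trans[OF integral_abs_bound integral_mono]) (use int(1)[OF that] bound in auto)
    then show "1 \<le> m" using * by (simp add: prob_space)
  qed
  have nonneg: "0 \<le> (2 + f x) / m" for x
    using bound[of x] m(2)[of P] by (auto simp: abs_le_iff)
  have D: "real_distribution (D M)" "char (D M) s = (2 * (CLINT x|M. iexp (s * Y x)) + (CLINT x|M. f x * iexp (s * Y x))) / m"
    "measure (D M) B = (2 * (LINT x|M. indicator B (Y x)) + (LINT x|M. f x * indicator B (Y x))) / m"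
    if M: "M = P \<or> M = Q" for M s
  proof -
    interpret prob_space M using assms(1,2) that by auto
    have [measurable_cong]: "sets M = sets P" using that sets by auto
    have int_dens: "integrable M (\<lambda>x. (2 + f x) / m)" using int(1)[OF M] by auto
    have "(LINT x|M. (2 + f x) / m) = 1"
      using int(1)[OF M] m[OF M] by (simp add: prob_space)
    then have nn: "(\<integral>\<^sup>+x. ennreal ((2 + f x) / m) \<partial>M) = 1"
      unfolding nn_integral_eq_integral[OF int_dens AE_I2[OF nonneg]] by (simp only: ennreal_1)
    have "emeasure (density M (\<lambda>x. ennreal ((2 + f x) / m))) (space M)
        = (\<integral>\<^sup>+x. ennreal ((2 + f x) / m) * indicator (space M) x \<partial>M)"
      by (rule emeasure_density) auto
    also have "\<dots> = (\<integral>\<^sup>+x. ennreal ((2 + f x) / m) \<partial>M)"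
      by (rule nn_integral_cong) simp
    finally have "emeasure (density M (\<lambda>x. ennreal ((2 + f x) / m))) (space M) = 1"
      unfolding nn .
    then have "prob_space (density M (\<lambda>x. ennreal ((2 + f x) / m)))"
      by (intro prob_spaceI) simp
    then show rd: "real_distribution (D M)"
      unfolding D_def by (rule prob_space.real_distribution_distr) simp
    show "char (D M) s = (2 * (CLINT x|M. iexp (s * Y x)) + (CLINT x|M. f x * iexp (s * Y x))) / m"
    proof -
      have "char (D M) s = (CLINT x|M. ((2 + f x) / m) *\<^sub>R iexp (s * Y x))"
        unfolding D_def char_def
        by (subst integral_distr, simp, simp, subst integral_density) (auto simp: nonneg)
      also have "\<dots> = (CLINT x|M. (2 * iexp (s * Y x) + f x * iexp (s * Y x)) / m)"
        by (rule Bochner_Integration.integral_cong) (auto simp: scaleR_conv_of_real field_simps)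
      also have "\<dots> = (2 * (CLINT x|M. iexp (s * Y x)) + (CLINT x|M. f x * iexp (s * Y x))) / m"
        using int(4,5)[OF M] by simp
      finally show ?thesis .
    qed
    show "measure (D M) B = (2 * (LINT x|M. indicator B (Y x)) + (LINT x|M. f x * indicator B (Y x))) / m"
    proof -
      interpret R: real_distribution "D M" by (rule rd)
      have "measure (D M) B = (LINT y|D M. indicator B y)" by simp
      also have "\<dots> = (LINT x|M. ((2 + f x) / m) *\<^sub>R indicator B (Y x))"
        unfolding D_def
        by (subst integral_distr, simp, simp, subst integral_density) (auto simp: nonneg)
      also have "\<dots> = (LINT x|M. (2 * indicator B (Y x) + f x * indicator B (Y x)) / m)"
        by (rule Bochner_Integration.integral_cong) (auto simp: field_simps)
      also have "\<dots> = (2 * (LINT x|M. indicator B (Y x)) + (LINT x|M. f x * indicator B (Y x))) / m"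
        using int(2,3)[OF M] by simp
      finally show ?thesis .
    qed
  qed
  have eqD: "D P = D Q"
  proof (rule Levy_uniqueness)
    show "char (D P) = char (D Q)"
      unfolding fun_eq_iff D(2)[OF disjI1[OF refl]] D(2)[OF disjI2[OF refl]] char1 charf by simp
  qed (auto intro!: D(1))
  \<comment> \<open>The weight 2 contributes twice the unweighted probability of \<open>B\<close>.
    By \<open>char1\<close> this part is common to both measures and cancels, leaving the integral
    against \<open>f\<close>.\<close>
  have "distr P borel Y = distr Q borel Y"
  proof (rule Levy_uniqueness)
    show "char (distr P borel Y) = char (distr Q borel Y)"
      unfolding char_def using char1 by (auto simp: integral_distr fun_eq_iff)
  qed (auto intro!: prob_space.real_distribution_distr assms(1,2))
  then have "(LINT y|distr P borel Y. indicator B y :: real) = (LINT y|distr Q borel Y. indicator B y)"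
    by simp
  then have "(LINT x|P. indicator B (Y x) :: real) = (LINT x|Q. indicator B (Y x))"
    by (subst (asm) (1 2) integral_distr) auto
  with D(3)[of P] D(3)[of Q] m(2)[of P] show ?thesis
    unfolding eqD by simp
qed

text \<open>The coordinates are released one at a time: \<open>m\<close> of them are tested against sets and
  the remaining ones against characters.\<close>

lemma char_vec_unique:
  assumes P: "prob_space P" and Q: "prob_space Q"
    and sP: "sets P = sets (borel_vec k)" and sQ: "sets Q = sets (borel_vec k)"
    and ch: "\<And>a. (CLINT y|P. iexp (\<Sum>i<k. a i * y i)) = (CLINT y|Q. iexp (\<Sum>i<k. a i * y i))"
  shows "P = Q"
proof -
  interpret P: prob_space P by fact
  interpret Q: prob_space Q by fact
  have [measurable_cong]: "sets P = sets (borel_vec k)" "sets Q = sets (borel_vec k)" by fact+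
  have coord: "(\<lambda>y. y i) \<in> borel_measurable P" "(\<lambda>y. y i) \<in> borel_measurable Q" if "i < k" for i
    using that by (auto intro!: measurable_component_singleton
        simp: measurable_cong_sets[OF sP refl] measurable_cong_sets[OF sQ refl])
  have main: "(CLINT y|P. of_real (\<Prod>i<m. indicator (B i) (y i)) * iexp (\<Sum>i\<in>{m..<k}. a i * y i))
      = (CLINT y|Q. of_real (\<Prod>i<m. indicator (B i) (y i)) * iexp (\<Sum>i\<in>{m..<k}. a i * y i))"
    if "m \<le> k" "\<And>i. i < k \<Longrightarrow> B i \<in> sets borel" for m a and B :: "nat \<Rightarrow> real set"
    using that
  proof (induction m arbitrary: a B)
    case 0
    then show ?case using ch by (simp add: atLeast0LessThan)
  next
    case (Suc m)
    define w :: "(nat \<Rightarrow> real) \<Rightarrow> real" where "w y = (\<Prod>i<m. indicator (B i) (y i))" for y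
    define \<theta> where "\<theta> y = (\<Sum>i\<in>{Suc m..<k}. a i * y i)" for y :: "nat \<Rightarrow> real"
    have mk: "m < k" using Suc.prems by simp
    have [measurable]: "(\<lambda>y. y m) \<in> borel_measurable P" "(\<lambda>y. y m) \<in> borel_measurable Q"
      using coord mk by auto
    have [measurable]: "w \<in> borel_measurable P" "w \<in> borel_measurable Q"
      unfolding w_def using Suc.prems mk
      by (auto intro!: borel_measurable_prod measurable_compose[OF coord(1) borel_measurable_indicator]
          measurable_compose[OF coord(2) borel_measurable_indicator])
    have [measurable]: "\<theta> \<in> borel_measurable P" "\<theta> \<in> borel_measurable Q"
      unfolding \<theta>_def by (auto intro!: borel_measurable_sum borel_measurable_times coord)
    have w1: "\<bar>w y\<bar> \<le> 1" for y
      unfolding w_def abs_prod by (rule prod_le_1) (auto split: split_indicator)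
    have split: "(\<Sum>i\<in>{m..<k}. (a'(m := s)) i * y i) = s * y m + (\<Sum>i\<in>{Suc m..<k}. a' i * y i)" for a' s and y :: "nat \<Rightarrow> real"
      using mk by (subst sum.atLeast_Suc_lessThan) auto
    \<comment> \<open>\<open>weighted_char_unique\<close> takes real weights only, whereas the
      remaining coordinates enter through a complex exponential. The induction hypothesis with
      coefficients \<open>a\<close> and with \<open>- a\<close> supplies both signs of
      \<open>\<theta> y\<close>; half sum and half difference give the real weights
      \<open>w y * cos (\<theta> y)\<close> and \<open>w y * sin (\<theta> y)\<close>.\<close>
    have plus: "(CLINT y|P. w y * iexp (s * y m + \<theta> y)) = (CLINT y|Q. w y * iexp (s * y m + \<theta> y))" for s
      using Suc.IH[of B "a(m := s)"] Suc.prems unfolding split w_def \<theta>_def by simp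
    have minus: "(CLINT y|P. w y * iexp (s * y m - \<theta> y)) = (CLINT y|Q. w y * iexp (s * y m - \<theta> y))" for s
      using Suc.IH[of B "(\<lambda>i. - a i)(m := s)"] Suc.prems unfolding split w_def \<theta>_def
      by (simp add: sum_negf)
    \<comment> \<open>The sets \<open>UNIV\<close> turn the weight into 1 and zero coefficients
      remove the later coordinates.\<close>
    have one: "(CLINT y|P. iexp (s * y m)) = (CLINT y|Q. iexp (s * y m))" for s
      using Suc.IH[of "\<lambda>_. UNIV" "(\<lambda>i. 0)(m := s)"] Suc.prems unfolding split by simp
    have int: "integrable M (\<lambda>y. w y * iexp (s * y m + \<theta> y))" "integrable M (\<lambda>y. w y * iexp (s * y m - \<theta> y))"
      "integrable M (\<lambda>y. w y * cos (\<theta> y) * indicator (B m) (y m))"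
      "integrable M (\<lambda>y. w y * sin (\<theta> y) * indicator (B m) (y m))"
      if "M = P \<or> M = Q" for M s
    proof -
      interpret prob_space M using P Q that by auto
      have [measurable]: "(\<lambda>y. y m) \<in> borel_measurable M" "w \<in> borel_measurable M" "\<theta> \<in> borel_measurable M"
        "B m \<in> sets borel"
        using that Suc.prems by auto
      show "integrable M (\<lambda>y. w y * iexp (s * y m + \<theta> y))" "integrable M (\<lambda>y. w y * iexp (s * y m - \<theta> y))"
        using w1 by (auto intro!: integrable_const_bound[where B = 1] simp: norm_mult simp flip: of_real_mult of_real_add of_real_diff)
      show "integrable M (\<lambda>y. w y * cos (\<theta> y) * indicator (B m) (y m))"
        "integrable M (\<lambda>y. w y * sin (\<theta> y) * indicator (B m) (y m))"
        using w1 by (auto intro!: integrable_const_bound[where B = 1] AE_I2 mult_le_one simp: abs_mult split: split_indicator)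
    qed
    have cs: "complex_of_real (w y * cos (\<theta> y)) * iexp (s * y m) = (w y * iexp (s * y m + \<theta> y) + w y * iexp (s * y m - \<theta> y)) / 2"
      "complex_of_real (w y * sin (\<theta> y)) * iexp (s * y m) = (w y * iexp (s * y m + \<theta> y) - w y * iexp (s * y m - \<theta> y)) / (2 * \<i>)" for y s
    proof -
      have e: "iexp (s * y m + \<theta> y) = iexp (s * y m) * cis (\<theta> y)" "iexp (s * y m - \<theta> y) = iexp (s * y m) * cis (- \<theta> y)"
        by (simp_all add: cis_conv_exp exp_add[symmetric] algebra_simps)
      have c: "complex_of_real (cos (\<theta> y)) = (cis (\<theta> y) + cis (- \<theta> y)) / 2"
        "complex_of_real (sin (\<theta> y)) = (cis (\<theta> y) - cis (- \<theta> y)) / (2 * \<i>)"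
        by (simp_all add: complex_eq_iff Re_divide Im_divide power2_eq_square)
      show "complex_of_real (w y * cos (\<theta> y)) * iexp (s * y m) = (w y * iexp (s * y m + \<theta> y) + w y * iexp (s * y m - \<theta> y)) / 2"
        "complex_of_real (w y * sin (\<theta> y)) * iexp (s * y m) = (w y * iexp (s * y m + \<theta> y) - w y * iexp (s * y m - \<theta> y)) / (2 * \<i>)"
        unfolding e of_real_mult c by (simp_all add: field_simps)
    qed
    have B: "B m \<in> sets borel" using Suc.prems mk by auto
    have "(LINT y|P. w y * cos (\<theta> y) * indicator (B m) (y m)) = (LINT y|Q. w y * cos (\<theta> y) * indicator (B m) (y m))"
    proof (rule weighted_char_unique[OF P Q _ _ _ _ one _ B])
      show "\<bar>w y * cos (\<theta> y)\<bar> \<le> 1" for y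
        using w1 by (auto simp: abs_mult intro!: mult_le_one)
      show "(CLINT y|P. complex_of_real (w y * cos (\<theta> y)) * iexp (s * y m)) = (CLINT y|Q. complex_of_real (w y * cos (\<theta> y)) * iexp (s * y m))" for s
        unfolding cs using int(1,2)[of P s] int(1,2)[of Q s] plus[of s] minus[of s] by simp
    qed (simp_all add: sP sQ)
    moreover have "(LINT y|P. w y * sin (\<theta> y) * indicator (B m) (y m)) = (LINT y|Q. w y * sin (\<theta> y) * indicator (B m) (y m))"
    proof (rule weighted_char_unique[OF P Q _ _ _ _ one _ B])
      show "\<bar>w y * sin (\<theta> y)\<bar> \<le> 1" for y
        using w1 by (auto simp: abs_mult intro!: mult_le_one)
      show "(CLINT y|P. complex_of_real (w y * sin (\<theta> y)) * iexp (s * y m)) = (CLINT y|Q. complex_of_real (w y * sin (\<theta> y)) * iexp (s * y m))" for s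
        unfolding cs using int(1,2)[of P s] int(1,2)[of Q s] plus[of s] minus[of s] by simp
    qed (simp_all add: sP sQ)
    moreover have "(CLINT y|M. of_real (\<Prod>i<Suc m. indicator (B i) (y i)) * iexp (\<Sum>i\<in>{Suc m..<k}. a i * y i))
      = of_real (LINT y|M. w y * cos (\<theta> y) * indicator (B m) (y m)) + \<i> * of_real (LINT y|M. w y * sin (\<theta> y) * indicator (B m) (y m))"
      if M: "M = P \<or> M = Q" for M
    proof -
      have "(CLINT y|M. of_real (\<Prod>i<Suc m. indicator (B i) (y i)) * iexp (\<Sum>i\<in>{Suc m..<k}. a i * y i))
        = (CLINT y|M. complex_of_real (w y * cos (\<theta> y) * indicator (B m) (y m)) + \<i> * complex_of_real (w y * sin (\<theta> y) * indicator (B m) (y m)))"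
      proof (rule Bochner_Integration.integral_cong[OF refl])
        fix y
        have "of_real (\<Prod>i<Suc m. indicator (B i) (y i)) * iexp (\<Sum>i\<in>{Suc m..<k}. a i * y i)
          = complex_of_real (w y * indicator (B m) (y m)) * cis (\<theta> y)"
          by (simp only: w_def \<theta>_def prod.lessThan_Suc cis_conv_exp)
        then show "of_real (\<Prod>i<Suc m. indicator (B i) (y i)) * iexp (\<Sum>i\<in>{Suc m..<k}. a i * y i)
          = complex_of_real (w y * cos (\<theta> y) * indicator (B m) (y m)) + \<i> * complex_of_real (w y * sin (\<theta> y) * indicator (B m) (y m))"
          by (simp add: complex_eq_iff)
      qed
      also have "\<dots> = of_real (LINT y|M. w y * cos (\<theta> y) * indicator (B m) (y m)) + \<i> * of_real (LINT y|M. w y * sin (\<theta> y) * indicator (B m) (y m))"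
        using int(3,4)[OF M] by (subst Bochner_Integration.integral_add) (auto simp flip: of_real_mult)
      finally show ?thesis .
    qed
    ultimately show ?case by simp
  qed
  show ?thesis
  proof (rule measure_eqI_PiM_finite[of "{..<k}" P "\<lambda>_. borel" Q "\<lambda>_. space P"])
    fix A :: "nat \<Rightarrow> real set" assume A: "\<And>i. i \<in> {..<k} \<Longrightarrow> A i \<in> sets borel"
    have ps: "Pi\<^sub>E {..<k} A \<in> sets (borel_vec k)"
      using A by (intro sets_PiM_I_finite) auto
    have ind: "(\<Prod>i<k. indicator (A i) (y i)) = (indicator (Pi\<^sub>E {..<k} A) y :: real)" if "y \<in> extensional {..<k}" for y
      using that by (auto simp: indicator_def PiE_iff)
    have "(LINT y|M. (\<Prod>i<k. indicator (A i) (y i))) = measure M (Pi\<^sub>E {..<k} A)"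
      if "sets M = sets (borel_vec k)" for M
    proof -
      have "(LINT y|M. (\<Prod>i<k. indicator (A i) (y i))) = (LINT y|M. indicator (Pi\<^sub>E {..<k} A) y :: real)"
        by (rule Bochner_Integration.integral_cong)
          (auto intro!: ind simp: sets_eq_imp_space_eq[OF that] space_PiM PiE_iff)
      then show ?thesis using ps that by simp
    qed
    \<comment> \<open>With \<open>m = k\<close> all coordinates are released and the character is
      trivial, so \<open>main\<close> compares the measures of boxes, which generate the
      \<sigma>-field.\<close>
    moreover have "complex_of_real (LINT y|P. (\<Prod>i<k. indicator (A i) (y i))) = complex_of_real (LINT y|Q. (\<Prod>i<k. indicator (A i) (y i)))"
      using main[of k A "\<lambda>_. 0"] A by (simp del: of_real_prod)
    ultimately have "measure P (Pi\<^sub>E {..<k} A) = measure Q (Pi\<^sub>E {..<k} A)"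
      using sP sQ by (simp only: of_real_eq_iff)
    then show "emeasure P (Pi\<^sub>E {..<k} A) = emeasure Q (Pi\<^sub>E {..<k} A)"
      by (simp add: P.emeasure_eq_measure Q.emeasure_eq_measure)
  next
    have "space P = Pi\<^sub>E {..<k} (\<lambda>_. UNIV)"
      using sets_eq_imp_space_eq[OF sP] by (simp add: space_PiM)
    then show "range (\<lambda>_. space P) \<subseteq> prod_algebra {..<k} (\<lambda>_. borel)"
      by (auto intro!: prod_algebraI_finite)
  qed (use sP sQ sets_eq_imp_space_eq[OF sP] in auto)
qed

section \<open>The set function and an arbitrary Wiener measure\<close>

lemma multivariate_normal_unique:
  "multivariate_normal k (\<lambda>_. 0) \<Sigma> N \<Longrightarrow> multivariate_normal k (\<lambda>_. 0) \<Sigma> N' \<Longrightarrow> N = N'"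
  by (rule char_vec_unique[where k = k])
    (simp_all only: char_linear_multivariate_normal, simp_all add: multivariate_normal_def)

section \<open>Cylinders over projections of compact sets\<close>

lemma measurable_pi [measurable]: "\<pi> k u \<in> borel \<rightarrow>\<^sub>M borel_vec k"
  unfolding \<pi>_def[abs_def] by (intro measurable_restrict) measurable

lemma tendsto_eval: "(X \<longlongrightarrow> x) F \<Longrightarrow> ((\<lambda>n. eval (X n) s) \<longlongrightarrow> eval x s) F"
  by (rule bounded_linear.tendsto[OF bounded_linear_eval])

text \<open>\<open>borel_vec n\<close> is a product \<sigma>-field on extensional functions, so
  measurability is not read off from closedness of the image. Instead a countable dense subset of
  \<open>K\<close> describes the image by countably many conditions; compactness turns approximation
  by points of \<open>K\<close> into attainment.\<close>

lemma image_pi_compact_in_sets: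
  assumes "compact K"
  shows "\<pi> n t ` K \<in> sets (borel_vec n)"
proof -
  obtain D where D: "countable D" "D \<subseteq> K" "K \<subseteq> closure D"
    using separable by metis
  define S where "S = {y \<in> space (borel_vec n). \<forall>m. \<exists>x\<in>D. \<forall>i<n. \<bar>y i - eval x (t i)\<bar> < 1 / Suc m}"
  have "\<pi> n t x \<in> S" if "x \<in> K" for x
  proof -
    have "\<exists>d\<in>D. \<forall>i<n. \<bar>\<pi> n t x i - eval d (t i)\<bar> < 1 / Suc m" for m
    proof -
      have "x \<in> closure D" using that D by auto
      then obtain d where d: "d \<in> D" "dist d x < 1 / Suc m"
        unfolding closure_approachable by (metis of_nat_0_less_iff zero_less_Suc zero_less_divide_1_iff)
      have "\<bar>\<pi> n t x i - eval d (t i)\<bar> < 1 / Suc m" if "i < n" for i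
        using that d(2) abs_eval_diff_le_dist[of x "t i" d] by (simp add: \<pi>_def dist_commute)
      with d(1) show ?thesis by blast
    qed
    then show ?thesis by (auto simp: S_def space_PiM \<pi>_def)
  qed
  moreover have "y \<in> \<pi> n t ` K" if y: "y \<in> S" for y
  proof -
    have "\<forall>m. \<exists>x. x \<in> K \<and> (\<forall>i<n. \<bar>y i - eval x (t i)\<bar> < 1 / Suc m)"
      using y D(2) unfolding S_def by blast
    then obtain x where x: "\<And>m. x m \<in> K" "\<And>m i. i < n \<Longrightarrow> \<bar>y i - eval (x m) (t i)\<bar> < 1 / Suc m"
      by metis
    obtain z r where z: "z \<in> K" "strict_mono r" "(x \<circ> r) \<longlonglongrightarrow> z"
      using assms x(1) unfolding compact_def by blast
    have "y i = eval z (t i)" if i: "i < n" for i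
    proof -
      have "(\<lambda>m. eval (x m) (t i) - y i) \<longlonglongrightarrow> 0"
      proof (rule Lim_null_comparison)
        show "\<forall>\<^sub>F m in sequentially. norm (eval (x m) (t i) - y i) \<le> 1 / Suc m"
          using x(2)[OF i] by (auto simp: abs_minus_commute intro!: always_eventually less_imp_le)
        show "(\<lambda>m. 1 / Suc m) \<longlonglongrightarrow> 0"
          using LIMSEQ_Suc[OF lim_1_over_n[where 'a=real]] by simp
      qed
      then have "(\<lambda>m. eval ((x \<circ> r) m) (t i)) \<longlonglongrightarrow> y i"
        using LIMSEQ_subseq_LIMSEQ[OF _ z(2)] by (auto simp: LIM_zero_iff o_def)
      then show ?thesis
        using tendsto_eval[OF z(3)] LIMSEQ_unique by blast
    qed
    moreover have "y \<in> extensional {..<n}" using y by (auto simp: S_def space_PiM PiE_iff)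
    ultimately have "y = \<pi> n t z" by (auto simp: \<pi>_def extensional_def fun_eq_iff)
    with z(1) show ?thesis by blast
  qed
  ultimately have "\<pi> n t ` K = S" by blast
  moreover have "S \<in> sets (borel_vec n)"
  proof -
    have "S = (\<Inter>m. \<Union>x\<in>D. {y \<in> space (borel_vec n). \<forall>i\<in>{..<n}. \<bar>y i - eval x (t i)\<bar> < 1 / Suc m})"
      by (auto simp: S_def Ball_def)
    moreover have "{y \<in> space (borel_vec n). \<forall>i\<in>{..<n}. \<bar>y i - eval x (t i)\<bar> < 1 / Suc m} \<in> sets (borel_vec n)" for x m
      by measurable
    ultimately show ?thesis using D(1)
      by (auto intro!: sets.countable_INT sets.countable_UN'')
  qed
  ultimately show ?thesis by simp
qed

text \<open>A point \<open>x\<close> in every cylinder agrees at the first \<open>n\<close> times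
  with some \<open>y n\<close> in \<open>K\<close>. Compactness merges these functions into a limit
  \<open>z\<close> in \<open>K\<close> that agrees with \<open>x\<close> at all times
  \<open>t i\<close>; continuity does the rest.\<close>

lemma INT_vimage_image_pi:
  assumes "compact K" "range t \<subseteq> {0..1}" "{0..1} \<subseteq> closure (range t)"
  shows "(\<Inter>n. \<pi> n t -` (\<pi> n t ` K)) = K"
proof (rule antisym)
  show "(\<Inter>n. \<pi> n t -` (\<pi> n t ` K)) \<subseteq> K"
  proof
    fix x assume "x \<in> (\<Inter>n. \<pi> n t -` (\<pi> n t ` K))"
    then have "\<forall>n. \<exists>y. y \<in> K \<and> \<pi> n t x = \<pi> n t y" by blast
    then obtain y where y: "\<And>n. y n \<in> K" "\<And>n. \<pi> n t x = \<pi> n t (y n)" by metis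
    have yx: "eval (y n) (t i) = eval x (t i)" if "i < n" for i n
      using fun_cong[OF y(2)[of n], of i] that by (simp add: \<pi>_def)
    obtain z r where z: "z \<in> K" "strict_mono r" "(y \<circ> r) \<longlonglongrightarrow> z"
      using assms(1) y(1) unfolding compact_def by blast
    have "eval z (t i) = eval x (t i)" for i
    proof (rule LIMSEQ_unique[OF tendsto_eval[OF z(3)]])
      \<comment> \<open>Since \<open>r n\<close> is at least \<open>n\<close>, the values at
        \<open>t i\<close> are eventually constant along the subsequence.\<close>
      have "eval ((y \<circ> r) n) (t i) = eval x (t i)" if "n > i" for n
        using yx[of i "r n"] that seq_suble[OF z(2), of n] by simp
      then show "(\<lambda>n. eval ((y \<circ> r) n) (t i)) \<longlonglongrightarrow> eval x (t i)"
        by (intro tendsto_eventually) (auto simp: eventually_at_top_dense)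
    qed
    then have zx: "eval (z - x) s = 0" if "s \<in> range t" for s using that by auto
    have "closure (range t) \<subseteq> {0..1}"
      using assms(2) by (intro closure_minimal) auto
    then have "continuous_on (closure (range t)) (eval (z - x))"
      using continuous_on_eval continuous_on_subset by blast
    then have "eval (z - x) s = 0" if "s \<in> {0..1}" for s
      using continuous_constant_on_closure[of "range t" "eval (z - x)" 0 s] zx that assms(3) by auto
    then have "z = x" by (intro C0_eqI) auto
    with z(1) show "x \<in> K" by simp
  qed
qed auto

section \<open>Comparison of the set function with a given Wiener measure\<close>

locale wiener =
  fixes W :: "C0 measure"
  assumes wiener: "is_wiener_measure W"
begin

sublocale prob_space W
  using wiener by (simp add: is_wiener_measure_def)

lemma sets_W [measurable_cong]: "sets W = sets borel"
  using wiener by (simp add: is_wiener_measure_def)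

lemma space_W [simp]: "space W = UNIV"
  using sets_eq_imp_space_eq[OF sets_W] by simp

text \<open>The marginal of \<open>W\<close> provides the existence that \<open>THE\<close> asks
  for; uniqueness is \<open>multivariate_normal_unique\<close>.\<close>

lemma nu_eq_distr:
  assumes "t ` {..<n} \<subseteq> {0..1}"
  shows "\<nu> n t = distr W (borel_vec n) (\<pi> n t)"
proof -
  have "multivariate_normal n (\<lambda>_. 0) (\<lambda>i j. min (t i) (t j)) (distr W (borel_vec n) (\<pi> n t))"
    using wiener assms by (simp add: is_wiener_measure_def brownian_marginals_def)
  then show ?thesis
    unfolding \<nu>_def using multivariate_normal_unique by (intro the_equality) blast+
qed

text \<open>\<open>extend_measure\<close> keeps the prescribed values only if some measure on the
  generated \<sigma>-field has them; \<open>W\<close> restricted to the cylinders is such a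
  measure.\<close>

lemma measure_alpha:
  assumes "t ` {..<n} \<subseteq> {0..1}" "B \<in> sets (borel_vec n)"
  shows "measure (\<alpha> n t) (\<pi> n t -` B) = measure W (\<pi> n t -` B)"
proof -
  let ?G = "\<lambda>B. \<pi> n t -` B"
  have nu: "emeasure W (?G B) = emeasure (\<nu> n t) B" if "B \<in> sets (borel_vec n)" for B
    unfolding nu_eq_distr[OF assms(1)] using that by (subst emeasure_distr) auto
  have "?G B \<in> sets borel" if "B \<in> sets (borel_vec n)" for B
    using measurable_sets[OF measurable_pi that] by simp
  then have "sigma_sets UNIV (?G ` sets (borel_vec n)) \<subseteq> sets W"
    using sets_W by (intro sets.sigma_sets_subset'[where M = W, simplified]) auto
  then have sub: "sets (\<alpha> n t) \<subseteq> sets W"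
    by (simp add: \<alpha>_def sets_extend_measure)
  have "emeasure (\<alpha> n t) (?G B) = emeasure (\<nu> n t) B"
  proof (rule emeasure_extend_measure[OF \<alpha>_def, where \<mu>' = "emeasure W"])
    show "positive (sets (\<alpha> n t)) (emeasure W)" by (simp add: positive_def)
    show "countably_additive (sets (\<alpha> n t)) (emeasure W)"
      unfolding countably_additive_def using sub by (auto intro!: suminf_emeasure)
  qed (use nu assms in auto)
  then show ?thesis using nu[OF assms(2)] by (simp add: measure_def)
qed

lemma phi_compact:
  assumes "range t \<subseteq> {0..1}" "{0..1} \<subseteq> closure (range t)" "compact K"
  shows "\<phi> t K = measure W K"
proof (cases "K = UNIV")
  \<comment> \<open>On the whole space \<open>\<phi>\<close> is 1 by convention, in agreement with
    the total mass of \<open>W\<close>.\<close>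
  case True
  then show ?thesis using prob_space by (simp add: \<phi>_def)
next
  case False
  let ?C = "\<lambda>n. \<pi> n t -` (\<pi> n t ` K)"
  have img: "\<pi> n t ` K \<in> sets (borel_vec n)" for n
    by (rule image_pi_compact_in_sets) fact
  have "range ?C \<subseteq> sets W"
    using measurable_sets[OF measurable_pi img] sets_W by auto
  moreover have "decseq ?C"
  proof (rule decseq_SucI)
    fix n
    have "\<pi> n t x = \<pi> n t y" if "\<pi> (Suc n) t x = \<pi> (Suc n) t y" for x y
    proof -
      have "eval x (t i) = eval y (t i)" if "i < n" for i
        using fun_cong[OF \<open>\<pi> (Suc n) t x = \<pi> (Suc n) t y\<close>, of i] that by (simp add: \<pi>_def)
      then show ?thesis by (auto simp: \<pi>_def restrict_def)
    qed
    then show "?C (Suc n) \<subseteq> ?C n" by blast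
  qed
  ultimately have "(\<lambda>n. measure W (?C n)) \<longlonglongrightarrow> measure W (\<Inter>n. ?C n)"
    by (rule finite_Lim_measure_decseq)
  moreover have "measure (\<alpha> n t) (?C n) = measure W (?C n)" for n
    using assms(1) img by (intro measure_alpha) auto
  ultimately show ?thesis
    using False INT_vimage_image_pi[OF assms(3,1,2)] by (simp add: \<phi>_def limI)
qed

lemma mu_eq_measure:
  assumes "range t \<subseteq> {0..1}" "{0..1} \<subseteq> closure (range t)" "A \<in> sets borel"
  shows "\<mu> t A = measure W A"
proof -
  let ?\<K> = "{K. compact K \<and> K \<subseteq> A}"
  have phi: "\<phi> t K = measure W K" if "K \<in> ?\<K>" for K
    using that assms by (auto intro: phi_compact)
  have le: "measure W K \<le> measure W A" if "K \<in> ?\<K>" for K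
    using that assms(3) sets_W by (intro finite_measure_mono) auto
  \<comment> \<open>A real supremum is governed by its elements only for a nonempty family that is
    bounded above.\<close>
  have ne: "?\<K> \<noteq> {}" by (auto intro!: exI[of _ "{}"])
  have bdd: "bdd_above (\<phi> t ` ?\<K>)"
    using phi le by (intro bdd_aboveI2[of _ _ "measure W A"]) auto
  have "\<mu> t A \<le> measure W A"
    unfolding \<mu>_def using ne phi le by (intro cSUP_least) auto
  moreover have "measure W A \<le> \<mu> t A"
  proof (rule dense_le)
    fix y assume y: "y < measure W A"
    show "y \<le> \<mu> t A"
    \<comment> \<open>\<open>ennreal\<close> sends negative numbers to 0, so the passage through
      \<open>emeasure\<close> is reserved for nonnegative \<open>y\<close>; below 0 the empty
      compact set suffices.\<close>
    proof (cases "y < 0")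
      case True
      have "\<phi> t {} \<le> \<mu> t A"
        unfolding \<mu>_def by (rule cSUP_upper[OF _ bdd]) auto
      with True phi[of "{}"] show ?thesis by simp
    next
      case False
      have "emeasure W A = (SUP K\<in>{K. K \<subseteq> A \<and> compact K}. emeasure W K)"
        using assms(3) by (intro inner_regular) (auto simp: sets_W)
      moreover have "ennreal y < emeasure W A"
        using y False by (simp add: emeasure_eq_measure ennreal_less_iff)
      ultimately obtain K where K: "K \<subseteq> A" "compact K" "ennreal y < emeasure W K"
        by (auto simp: less_SUP_iff)
      then have "y < measure W K"
        using False by (simp add: emeasure_eq_measure ennreal_less_iff)
      also have "\<dots> = \<phi> t K" using K phi by simp
      also have "\<dots> \<le> \<mu> t A"
        unfolding \<mu>_def by (rule cSUP_upper[OF _ bdd]) (use K in auto)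
      finally show ?thesis by simp
    qed
  qed
  ultimately show ?thesis by simp
qed

text \<open>Countable additivity is inherited from \<open>W\<close>, with which \<open>\<mu>\<close>
  agrees on Borel sets. This is also what \<open>measure_of\<close> requires in order to keep the
  values it is given.\<close>

lemma mu_measure_eq:
  assumes "range t \<subseteq> {0..1}" "{0..1} \<subseteq> closure (range t)"
  shows "measure_space UNIV (sets borel) (\<lambda>A. ennreal (\<mu> t A))" "\<mu>_measure t = W"
proof -
  have eq: "ennreal (\<mu> t A) = emeasure W A" if "A \<in> sets borel" for A
    using mu_eq_measure[OF assms that] by (simp add: emeasure_eq_measure)
  have *: "sigma_sets UNIV (sets borel) = sets (borel :: C0 measure)"
    using sets.sigma_sets_eq[of "borel :: C0 measure"] by simp
  have "measure_space UNIV (sets borel) (emeasure W)"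
    using measure_space[of W] by (simp add: sets_W)
  then show ms: "measure_space UNIV (sets borel) (\<lambda>A. ennreal (\<mu> t A))"
    using measure_space_eq[of "sets (borel :: C0 measure)" UNIV "\<lambda>A. ennreal (\<mu> t A)" "emeasure W"] eq
    unfolding * by simp
  show "\<mu>_measure t = W"
  proof (rule measure_eqI)
    show sets: "sets (\<mu>_measure t) = sets W"
      unfolding \<mu>_measure_def by (simp add: sets_W *)
    fix A assume "A \<in> sets (\<mu>_measure t)"
    then have A: "A \<in> sets borel" by (simp add: sets sets_W)
    then show "emeasure (\<mu>_measure t) A = emeasure W A"
      unfolding \<mu>_measure_def using ms eq[OF A]
      by (subst emeasure_measure_of_sigma) (auto simp: measure_space_def)
  qed
qed

end

section \<open>The covariance of the Schauder series\<close>

text \<open>The primitive of the Haar function that is 1 on the left half and -1 on the right half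
  of the unit interval. Its peak is 1/2.\<close>

definition tent :: "real \<Rightarrow> real" where
  "tent x = max 0 (min x (1 - x))"

lemma tent_nonneg: "0 \<le> tent x" and tent_le_1: "tent x \<le> 1"
  by (auto simp: tent_def)

lemma tent_eq_0: "x \<le> 0 \<or> 1 \<le> x \<Longrightarrow> tent x = 0"
  by (auto simp: tent_def)

lemma continuous_on_tent [continuous_intros]:
  "continuous_on S f \<Longrightarrow> continuous_on S (\<lambda>x. tent (f x))"
  unfolding tent_def by (intro continuous_intros)

text \<open>The supports of distinct shifts share at most end points, where the tents vanish, so
  only the shift by the integer part of \<open>x\<close> can contribute.\<close>

lemma sum_tent_shift_le_1: "(\<Sum>k<m. tent (x - real k)) \<le> 1"
proof -
  have "(\<Sum>k<m. tent (x - real k)) \<le> (\<Sum>k<m. if k = nat \<lfloor>x\<rfloor> then 1 else 0)"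
  proof (rule sum_mono)
    fix k
    have "x - real k \<le> 0 \<or> 1 \<le> x - real k" if "k \<noteq> nat \<lfloor>x\<rfloor>"
      using that by linarith
    then show "tent (x - real k) \<le> (if k = nat \<lfloor>x\<rfloor> then 1 else 0)"
      using tent_le_1 tent_eq_0 by auto
  qed
  also have "\<dots> \<le> 1" by (subst sum.delta) auto
  finally show ?thesis .
qed

text \<open>The covariance of the first \<open>N\<close> levels of the series, linear term excluded.
  The factor \<open>(1/2)^n\<close> is the squared amplitude of a Schauder function of level
  \<open>n\<close>.\<close>

definition schauder_cov :: "nat \<Rightarrow> real \<Rightarrow> real \<Rightarrow> real" where
  "schauder_cov N s t = (\<Sum>n<N. (1/2)^n * (\<Sum>k<2^n. tent (2^n * s - real k) * tent (2^n * t - real k)))"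

text \<open>The covariance of the Brownian bridge, extended by 0 so that the recursion holds for all
  real arguments, including rescaled ones that leave the unit interval.\<close>

definition bridge_cov :: "real \<Rightarrow> real \<Rightarrow> real" where
  "bridge_cov s t = (if s \<in> {0..1} \<and> t \<in> {0..1} then min s t - s * t else 0)"

text \<open>By self-similarity of the tents, \<open>schauder_cov\<close> and \<open>bridge_cov\<close> obey the same recursion. At
  most one of its two rescaled terms is nonzero, so each step halves the error.\<close>

lemma schauder_cov_Suc:
  "schauder_cov (Suc N) s t =
    tent s * tent t + (schauder_cov N (2 * s) (2 * t) + schauder_cov N (2 * s - 1) (2 * t - 1)) / 2"
proof -
  define g where "g = (\<lambda>n s t. (\<Sum>k<2^n. tent (2^n * s - real k) * tent (2^n * t - real k)))"
  have g: "schauder_cov N s t = (\<Sum>n<N. (1/2)^n * g n s t)" for N s t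
    by (simp add: schauder_cov_def g_def)
  \<comment> \<open>The indices below \<open>2^n\<close> live on the left half of the unit interval
    and give the arguments \<open>2 * s\<close>, \<open>2 * t\<close>; shifting the others by
    \<open>2^n\<close> gives \<open>2 * s - 1\<close>, \<open>2 * t - 1\<close>.\<close>
  have g_Suc: "g (Suc n) s t = g n (2 * s) (2 * t) + g n (2 * s - 1) (2 * t - 1)" for n
  proof -
    have "g (Suc n) s t = (\<Sum>k\<in>{..<2^n} \<union> {2^n..<2^n+2^n}. tent (2^Suc n * s - real k) * tent (2^Suc n * t - real k))"
      unfolding g_def by (rule sum.cong) auto
    also have "\<dots> = (\<Sum>k<2^n. tent (2^Suc n * s - real k) * tent (2^Suc n * t - real k))
      + (\<Sum>k\<in>{2^n..<2^n+2^n}. tent (2^Suc n * s - real k) * tent (2^Suc n * t - real k))"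
      by (rule sum.union_disjoint) auto
    also have "(\<Sum>k\<in>{2^n..<2^n+2^n}. tent (2^Suc n * s - real k) * tent (2^Suc n * t - real k))
      = (\<Sum>k<2^n. tent (2^Suc n * s - real (k + 2^n)) * tent (2^Suc n * t - real (k + 2^n)))"
      using sum.shift_bounds_nat_ivl[of "\<lambda>k. tent (2^Suc n * s - real k) * tent (2^Suc n * t - real k)" 0 "2^n" "2^n"]
      by (simp add: atLeast0LessThan)
    finally show ?thesis by (simp add: g_def algebra_simps)
  qed
  have "(1/2)^Suc n * g (Suc n) s t = (1/2)^n * g n (2 * s) (2 * t) / 2 + (1/2)^n * g n (2 * s - 1) (2 * t - 1) / 2" for n
    unfolding g_Suc by (simp add: field_simps)
  moreover have "g 0 s t = tent s * tent t" by (simp add: g_def)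
  ultimately show ?thesis
    unfolding g sum.lessThan_Suc_shift by (simp add: sum.distrib add_divide_distrib sum_divide_distrib)
qed

lemma schauder_cov_eq_0:
  assumes "s \<notin> {0<..<1} \<or> t \<notin> {0<..<1}" shows "schauder_cov N s t = 0"
proof -
  have "tent (2^n * r - real k) = 0" if "k < 2^n" "r \<notin> {0<..<1}" for n k and r :: real
  proof (rule tent_eq_0, cases "r \<le> 0")
    case True
    then have "2^n * r \<le> 0" by (simp add: mult_nonneg_nonpos)
    then show "2^n * r - real k \<le> 0 \<or> 1 \<le> 2^n * r - real k" by linarith
  next
    case False
    then have "2^n \<le> 2^n * r" using that by simp
    moreover have "real k + 1 \<le> 2^n"
      using that(1) by (metis Suc_leI add.commute of_nat_Suc of_nat_le_iff of_nat_numeral of_nat_power)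
    ultimately show "2^n * r - real k \<le> 0 \<or> 1 \<le> 2^n * r - real k" by linarith
  qed
  then have "(\<Sum>k<2^n. tent (2^n * s - real k) * tent (2^n * t - real k)) = 0" for n
    using assms by (intro sum.neutral) auto
  then show ?thesis by (simp add: schauder_cov_def)
qed

lemma bridge_cov_eq_0: "s \<notin> {0<..<1} \<or> t \<notin> {0<..<1} \<Longrightarrow> bridge_cov s t = 0"
  by (auto simp: bridge_cov_def min_def not_less)

text \<open>For points in different halves both rescaled terms vanish and
  \<open>min s t - s * t\<close> factors, as \<open>s * (1 - t)\<close> when \<open>s\<close> is the
  smaller. In a common half one rescaled term survives and supplies the difference from the product
  of tents.\<close>

lemma bridge_cov_rec:
  "bridge_cov s t = tent s * tent t + (bridge_cov (2 * s) (2 * t) + bridge_cov (2 * s - 1) (2 * t - 1)) / 2"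
proof -
  consider "s \<notin> {0..1} \<or> t \<notin> {0..1}" | "s \<in> {0..1/2}" "t \<in> {0..1/2}" | "s \<in> {1/2..1}" "t \<in> {1/2..1}"
    | "s \<in> {0..1/2}" "t \<in> {1/2..1}" | "s \<in> {1/2..1}" "t \<in> {0..1/2}" by fastforce
  then show ?thesis
  proof cases
    case 1
    then have "tent s * tent t = 0" by (auto intro: tent_eq_0)
    moreover have "bridge_cov (2 * s) (2 * t) = 0" "bridge_cov (2 * s - 1) (2 * t - 1) = 0" "bridge_cov s t = 0"
      using 1 by (auto intro!: bridge_cov_eq_0)
    ultimately show ?thesis by simp
  next
    case 2
    then have "bridge_cov (2 * s - 1) (2 * t - 1) = 0" by (intro bridge_cov_eq_0) auto
    with 2 show ?thesis by (auto simp: bridge_cov_def tent_def min_def max_def field_simps)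
  next
    case 3
    then have "bridge_cov (2 * s) (2 * t) = 0" by (intro bridge_cov_eq_0) auto
    moreover have ?thesis if "s = 1/2"
      using 3 unfolding that by (auto simp: bridge_cov_def tent_def min_def max_def field_simps)
    moreover have ?thesis if "t = 1/2"
      using 3 unfolding that by (auto simp: bridge_cov_def tent_def min_def max_def field_simps)
    moreover have ?thesis if "s \<noteq> 1/2" "t \<noteq> 1/2"
    proof -
      have "1/2 < s" "1/2 < t" using 3 that by auto
      with 3 \<open>bridge_cov (2 * s) (2 * t) = 0\<close> show ?thesis
        by (simp add: bridge_cov_def tent_def min_def max_def) (simp add: field_simps)
    qed
    ultimately show ?thesis by blast
  next
    case 4
    then have "bridge_cov (2 * s) (2 * t) = 0" "bridge_cov (2 * s - 1) (2 * t - 1) = 0"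
      by (auto intro!: bridge_cov_eq_0)
    with 4 show ?thesis by (auto simp: bridge_cov_def tent_def min_def max_def algebra_simps)
  next
    case 5
    then have "bridge_cov (2 * s) (2 * t) = 0" "bridge_cov (2 * s - 1) (2 * t - 1) = 0"
      by (auto intro!: bridge_cov_eq_0)
    with 5 show ?thesis by (auto simp: bridge_cov_def tent_def min_def max_def algebra_simps)
  qed
qed

lemma abs_schauder_cov_minus_bridge_cov: "\<bar>schauder_cov N s t - bridge_cov s t\<bar> \<le> (1/2)^N"
proof (induction N arbitrary: s t)
  case 0
  have "\<bar>min s t - s * t\<bar> \<le> 1" if "s \<in> {0..1}" "t \<in> {0..1}"
  proof -
    have "0 \<le> s * t" "s * t \<le> s" "s * t \<le> t"
      using that by (auto simp: mult_left_le mult_left_le_one_le)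
    with that show ?thesis by (auto simp: min_def)
  qed
  then show ?case by (auto simp: schauder_cov_def bridge_cov_def)
next
  case (Suc N)
  define a where "a = schauder_cov N (2 * s) (2 * t) - bridge_cov (2 * s) (2 * t)"
  define b where "b = schauder_cov N (2 * s - 1) (2 * t - 1) - bridge_cov (2 * s - 1) (2 * t - 1)"
  have eq: "schauder_cov (Suc N) s t - bridge_cov s t = (a + b) / 2"
    unfolding schauder_cov_Suc a_def b_def by (subst bridge_cov_rec) (simp add: field_simps)
  \<comment> \<open>For \<open>s\<close> at most 1/2 the point \<open>2 * s - 1\<close> is not in
    the open unit interval, otherwise \<open>2 * s\<close> is not; both covariances vanish there,
    end points included.\<close>
  have "a = 0 \<or> b = 0"
    unfolding a_def b_def using schauder_cov_eq_0 bridge_cov_eq_0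
    by (cases "s \<le> 1/2") auto
  moreover have "\<bar>a\<bar> \<le> (1/2)^N" "\<bar>b\<bar> \<le> (1/2)^N"
    unfolding a_def b_def by (rule Suc.IH)+
  ultimately have "\<bar>(a + b) / 2\<bar> \<le> (1/2)^Suc N" by auto
  with eq show ?case by metis
qed

text \<open>The linear term has covariance \<open>s * t\<close>, exactly what the bridge
  lacks.\<close>

lemma schauder_cov_tendsto:
  assumes "s \<in> {0..1}" "t \<in> {0..1}"
  shows "(\<lambda>N. s * t + schauder_cov N s t) \<longlonglongrightarrow> min s t"
proof -
  have "(\<lambda>N. schauder_cov N s t - bridge_cov s t) \<longlonglongrightarrow> 0"
    by (rule Lim_null_comparison[where g = "\<lambda>N. (1/2)^N"])
      (auto simp: abs_schauder_cov_minus_bridge_cov intro: LIMSEQ_realpow_zero)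
  then have "(\<lambda>N. s * t + bridge_cov s t + (schauder_cov N s t - bridge_cov s t)) \<longlonglongrightarrow> s * t + bridge_cov s t + 0"
    by (intro tendsto_intros)
  then show ?thesis using assms by (simp add: bridge_cov_def)
qed

section \<open>The Levy-Ciesielski construction\<close>

abbreviation gaussian_sequence :: "(nat \<times> nat \<Rightarrow> real) measure" where
  "gaussian_sequence \<equiv> \<Pi>\<^sub>M p\<in>UNIV. std_normal_distribution"

lemma prob_space_std_normal: "prob_space std_normal_distribution"
  by (rule prob_space_normal_density) simp

interpretation gaussian: prob_space gaussian_sequence
  by (intro prob_space_PiM prob_space_std_normal)

lemma gaussian_coordinate_measurable [measurable]: "(\<lambda>\<omega>. \<omega> p) \<in> borel_measurable gaussian_sequence"
  using measurable_component_singleton[of p UNIV "\<lambda>_. std_normal_distribution"]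
  by (simp cong: measurable_cong_sets)

lemma distr_gaussian_coordinate: "distr gaussian_sequence borel (\<lambda>\<omega>. \<omega> p) = std_normal_distribution"
proof -
  have "distr gaussian_sequence borel (\<lambda>\<omega>. \<omega> p) = distr gaussian_sequence std_normal_distribution (\<lambda>\<omega>. \<omega> p)"
    by (rule distr_cong) auto
  then show ?thesis
    using distr_PiM_component[of UNIV "\<lambda>_. std_normal_distribution" p] prob_space_std_normal by simp
qed

lemma indep_vars_gaussian: "gaussian.indep_vars (\<lambda>_. borel) (\<lambda>p \<omega>. \<omega> p) UNIV"
proof -
  have "distr gaussian_sequence (\<Pi>\<^sub>M p\<in>UNIV. borel) (\<lambda>\<omega>. \<lambda>p\<in>UNIV. \<omega> p) = distr gaussian_sequence gaussian_sequence (\<lambda>\<omega>. \<omega>)"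
    by (rule distr_cong) (auto intro!: sets_PiM_cong)
  then show ?thesis
    by (subst gaussian.indep_vars_iff_distr_eq_PiM) (simp_all add: distr_gaussian_coordinate)
qed

lemma char_gaussian_sum:
  assumes "finite I"
  shows "(CLINT \<omega>|gaussian_sequence. iexp (\<Sum>p\<in>I. c p * \<omega> p)) = of_real (exp (- (\<Sum>p\<in>I. (c p)\<^sup>2) / 2))"
proof -
  have char1: "char (distr gaussian_sequence borel (\<lambda>\<omega>. c p * \<omega> p)) 1 = of_real (exp (- (c p)\<^sup>2 / 2))" for p
  proof -
    have "char (distr gaussian_sequence borel (\<lambda>\<omega>. c p * \<omega> p)) 1 = (CLINT \<omega>|gaussian_sequence. iexp (c p * \<omega> p))"
      unfolding char_def by (subst integral_distr) auto
    also have "\<dots> = char (distr gaussian_sequence borel (\<lambda>\<omega>. \<omega> p)) (c p)"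
      unfolding char_def by (subst integral_distr) auto
    finally show ?thesis by (simp add: distr_gaussian_coordinate char_std_normal_distribution)
  qed
  have "gaussian.indep_vars (\<lambda>_. borel) (\<lambda>p \<omega>. c p * \<omega> p) I"
    by (rule gaussian.indep_vars_compose2[OF gaussian.indep_vars_subset[OF indep_vars_gaussian]]) auto
  then have "char (distr gaussian_sequence borel (\<lambda>\<omega>. \<Sum>p\<in>I. c p * \<omega> p)) 1 = (\<Prod>p\<in>I. of_real (exp (- (c p)\<^sup>2 / 2)))"
    by (simp add: gaussian.char_distr_sum char1)
  also have "\<dots> = of_real (exp (- (\<Sum>p\<in>I. (c p)\<^sup>2) / 2))"
    using assms by (simp add: exp_sum[symmetric] sum_negf[symmetric] sum_divide_distrib flip: of_real_prod)
  finally show ?thesis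
    unfolding char_def by (subst (asm) integral_distr) auto
qed

lemma gaussian_fourth_moment:
  "integrable gaussian_sequence (\<lambda>\<omega>. \<omega> p ^ 4)" "(LINT \<omega>|gaussian_sequence. \<omega> p ^ 4) = 3"
proof -
  have meas: "(\<lambda>x::real. x ^ 4) \<in> borel_measurable borel" by measurable
  show "integrable gaussian_sequence (\<lambda>\<omega>. \<omega> p ^ 4)"
    using integrable_distr_eq[OF gaussian_coordinate_measurable meas, of p] integrable_std_normal_power[of 4]
    by (simp add: distr_gaussian_coordinate)
  show "(LINT \<omega>|gaussian_sequence. \<omega> p ^ 4) = 3"
    using integral_distr[OF gaussian_coordinate_measurable meas, of p] integral_std_normal(3)
    by (simp add: distr_gaussian_coordinate)
qed

text \<open>Index \<open>(0, 0)\<close> is the linear function, index \<open>(n + 1, k)\<close> the \<open>k\<close>-th Schauder function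
  of level \<open>n\<close>.\<close>

fun schauder :: "nat \<times> nat \<Rightarrow> C0" where
  "schauder (0, k) = C0 (\<lambda>s. if s \<in> {0..1} then s else 0)"
| "schauder (Suc n, k) = C0 (\<lambda>s. if s \<in> {0..1} then (1 / sqrt 2) ^ n * tent (2 ^ n * s - real k) else 0)"

lemma eval_schauder:
  assumes "s \<in> {0..1}"
  shows "eval (schauder (0, k)) s = s"
    "eval (schauder (Suc n, k)) s = (1 / sqrt 2) ^ n * tent (2 ^ n * s - real k)"
proof -
  have "continuous_on {0..1} (\<lambda>s::real. if s \<in> {0..1} then s else 0)"
    by (rule continuous_on_eq[OF continuous_on_id]) auto
  then show "eval (schauder (0, k)) s = s"
    using assms by (simp add: C0_inverse)
  have "continuous_on {0..1} (\<lambda>s. if s \<in> {0..1} then (1 / sqrt 2) ^ n * tent (2 ^ n * s - real k) else 0)"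
    by (rule continuous_on_eq[where f = "\<lambda>s. (1 / sqrt 2) ^ n * tent (2 ^ n * s - real k)"])
      (auto intro!: continuous_intros)
  then show "eval (schauder (Suc n, k)) s = (1 / sqrt 2) ^ n * tent (2 ^ n * s - real k)"
    using assms by (simp add: C0_inverse tent_eq_0)
qed

section \<open>Almost sure convergence of the series\<close>

definition schauder_level :: "nat \<Rightarrow> (nat \<times> nat \<Rightarrow> real) \<Rightarrow> C0" where
  "schauder_level n \<omega> = (\<Sum>k<2^n. \<omega> (Suc n, k) *\<^sub>R schauder (Suc n, k))"

text \<open>Total by convention: \<open>suminf\<close> also has some value where the series
  diverges. Measurability holds regardless, and divergence is confined to a null set.\<close>

definition brownian :: "(nat \<times> nat \<Rightarrow> real) \<Rightarrow> C0" where
  "brownian \<omega> = \<omega> (0, 0) *\<^sub>R schauder (0, 0) + (\<Sum>n. schauder_level n \<omega>)"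

lemma measurable_schauder_level [measurable]: "schauder_level n \<in> borel_measurable gaussian_sequence"
  unfolding schauder_level_def[abs_def] by measurable

lemma measurable_brownian [measurable]: "brownian \<in> borel_measurable gaussian_sequence"
  unfolding brownian_def[abs_def] by measurable

text \<open>At each point at most one tent of a level is nonzero; \<open>\<bar>z\<bar> \<le> c + z^4 / c^3\<close> trades the
  maximum of the coefficients of a level for a sum of fourth powers.\<close>

lemma norm_schauder_level_le:
  assumes "c > 0"
  shows "norm (schauder_level n \<omega>) \<le> (1 / sqrt 2) ^ n * (c + (\<Sum>k<2^n. \<omega> (Suc n, k) ^ 4) / c ^ 3)"
proof (rule norm_C0_le)
  fix s :: real assume s: "s \<in> {0..1}"
  have z: "\<bar>z\<bar> \<le> c + z ^ 4 / c ^ 3" for z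
  proof (cases "\<bar>z\<bar> \<le> c")
    case True
    then show ?thesis using assms by (intro order_trans[OF True]) simp
  next
    case False
    then have "\<bar>z\<bar> * c ^ 3 \<le> \<bar>z\<bar> * \<bar>z\<bar> ^ 3"
      using assms by (intro mult_left_mono power_mono) auto
    also have "\<dots> = z ^ 4" by (simp add: power4_eq_xxxx power3_eq_cube abs_mult[symmetric] mult.assoc)
    finally have "\<bar>z\<bar> \<le> z ^ 4 / c ^ 3" using assms by (simp add: pos_le_divide_eq)
    then show ?thesis using assms by simp
  qed
  let ?t = "\<lambda>k. tent (2 ^ n * s - real k)"
  have "\<bar>eval (schauder_level n \<omega>) s\<bar> \<le> (\<Sum>k<2^n. \<bar>\<omega> (Suc n, k)\<bar> * ((1 / sqrt 2) ^ n * ?t k))"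
    unfolding schauder_level_def eval_sum eval_scaleR eval_schauder(2)[OF s]
    by (rule order_trans[OF sum_abs]) (simp add: abs_mult tent_nonneg)
  also have "\<dots> = (1 / sqrt 2) ^ n * (\<Sum>k<2^n. \<bar>\<omega> (Suc n, k)\<bar> * ?t k)"
    by (simp add: sum_distrib_left algebra_simps)
  \<comment> \<open>The tents stay next to \<open>c\<close>, where their sum is at most 1, and are
    bounded by 1 next to the fourth powers.\<close>
  also have "(\<Sum>k<2^n. \<bar>\<omega> (Suc n, k)\<bar> * ?t k) \<le> (\<Sum>k<2^n. c * ?t k + \<omega> (Suc n, k) ^ 4 / c ^ 3)"
  proof (rule sum_mono)
    fix k
    have "\<bar>\<omega> (Suc n, k)\<bar> * ?t k \<le> (c + \<omega> (Suc n, k) ^ 4 / c ^ 3) * ?t k"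
      by (intro mult_right_mono z tent_nonneg)
    also have "\<dots> \<le> c * ?t k + \<omega> (Suc n, k) ^ 4 / c ^ 3"
      using mult_left_mono[OF tent_le_1, of "\<omega> (Suc n, k) ^ 4 / c ^ 3" "2 ^ n * s - real k"] assms
      by (simp add: distrib_right)
    finally show "\<bar>\<omega> (Suc n, k)\<bar> * ?t k \<le> c * ?t k + \<omega> (Suc n, k) ^ 4 / c ^ 3" .
  qed
  also have "\<dots> = c * (\<Sum>k<2^n. ?t k) + (\<Sum>k<2^n. \<omega> (Suc n, k) ^ 4) / c ^ 3"
    by (simp add: sum.distrib sum_distrib_left sum_divide_distrib)
  also have "\<dots> \<le> c * 1 + (\<Sum>k<2^n. \<omega> (Suc n, k) ^ 4) / c ^ 3"
    using assms sum_tent_shift_le_1 by (intro add_mono mult_left_mono) auto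
  finally show "\<bar>eval (schauder_level n \<omega>) s\<bar> \<le> (1 / sqrt 2) ^ n * (c + (\<Sum>k<2^n. \<omega> (Suc n, k) ^ 4) / c ^ 3)"
    by (simp add: mult_left_mono)
qed

text \<open>The mean norm of level \<open>n\<close> is at most
  \<open>(1 / sqrt 2)^n * (c + 3 * 2^n / c^3)\<close>. The choice \<open>c = q^n\<close>, with
  \<open>q\<close> the fourth root of 2, balances the two terms and gives
  \<open>4 * (1 / q)^n\<close>. Second moments would not do: \<open>c + 2^n / c\<close> is at least
  \<open>2 * (sqrt 2)^n\<close> for every \<open>c > 0\<close>, which cancels the amplitude. A
  series with finite mean is finite almost surely.\<close>

lemma AE_summable_schauder_level: "AE \<omega> in gaussian_sequence. summable (\<lambda>n. schauder_level n \<omega>)"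
proof -
  define q :: real where "q = sqrt (sqrt 2)"
  have q2: "q\<^sup>2 = sqrt 2" and q1: "1 < q" by (simp_all add: q_def)
  have q4: "q ^ 4 = 2"
    using q2 by (simp add: power4_eq_xxxx power2_eq_square mult.assoc)
  have bound: "(\<integral>\<^sup>+\<omega>. ennreal (norm (schauder_level n \<omega>)) \<partial>gaussian_sequence) \<le> ennreal (4 * (1 / q) ^ n)" for n
  proof -
    let ?b = "\<lambda>\<omega>. (1 / sqrt 2) ^ n * (q ^ n + (\<Sum>k<2^n. \<omega> (Suc n, k) ^ 4) / (q ^ n) ^ 3)"
    have int: "integrable gaussian_sequence ?b"
      by (intro integrable_mult_right Bochner_Integration.integrable_add Bochner_Integration.integrable_divide
          Bochner_Integration.integrable_sum gaussian_fourth_moment(1)) simp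
    have "(LINT \<omega>|gaussian_sequence. ?b \<omega>) = (1 / sqrt 2) ^ n * (q ^ n + 2 ^ n * 3 / (q ^ n) ^ 3)"
      using gaussian_fourth_moment gaussian.prob_space
      by (simp add: Bochner_Integration.integral_add)
    also have "(2::real) ^ n = (q ^ n) ^ 4"
      unfolding q4[symmetric] by (simp add: power_mult[symmetric] mult.commute)
    also have "(q ^ n) ^ 4 * 3 / (q ^ n) ^ 3 = 3 * q ^ n"
      using q1 by (simp add: power4_eq_xxxx power3_eq_cube)
    also have "(1 / sqrt 2) ^ n * (q ^ n + 3 * q ^ n) = 4 * (1 / q) ^ n"
      using q1 unfolding q2[symmetric]
      by (simp add: power_divide power_mult[symmetric] mult_2_right power_add mult_2)
    finally have eq: "(LINT \<omega>|gaussian_sequence. ?b \<omega>) = 4 * (1 / q) ^ n" .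
    have le: "norm (schauder_level n \<omega>) \<le> ?b \<omega>" for \<omega>
      using norm_schauder_level_le[of "q ^ n"] q1 by simp
    have "(\<integral>\<^sup>+\<omega>. ennreal (norm (schauder_level n \<omega>)) \<partial>gaussian_sequence) \<le> (\<integral>\<^sup>+\<omega>. ennreal (?b \<omega>) \<partial>gaussian_sequence)"
      by (intro nn_integral_mono ennreal_leI le)
    also have "\<dots> = ennreal (LINT \<omega>|gaussian_sequence. ?b \<omega>)"
      by (intro nn_integral_eq_integral int AE_I2 order_trans[OF norm_ge_zero le])
    finally show ?thesis unfolding eq .
  qed
  have geo: "summable (\<lambda>n. 4 * (1 / q) ^ n)"
    using q1 by (intro summable_mult summable_geometric) simp
  have "(\<integral>\<^sup>+\<omega>. (\<Sum>n. ennreal (norm (schauder_level n \<omega>))) \<partial>gaussian_sequence)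
      = (\<Sum>n. \<integral>\<^sup>+\<omega>. ennreal (norm (schauder_level n \<omega>)) \<partial>gaussian_sequence)"
    by (rule nn_integral_suminf) measurable
  also have "\<dots> \<le> (\<Sum>n. ennreal (4 * (1 / q) ^ n))"
    by (intro suminf_le bound) auto
  also have "\<dots> = ennreal (\<Sum>n. 4 * (1 / q) ^ n)"
    using q1 geo by (intro suminf_ennreal2) auto
  also have "\<dots> < \<infinity>" by simp
  finally have "AE \<omega> in gaussian_sequence. (\<Sum>n. ennreal (norm (schauder_level n \<omega>))) \<noteq> \<infinity>"
    by (intro nn_integral_PInf_AE) auto
  then show ?thesis
  proof eventually_elim
    case (elim \<omega>)
    then have "summable (\<lambda>n. norm (schauder_level n \<omega>))"
      by (intro summable_suminf_not_top) auto
    then show ?case by (rule summable_norm_cancel)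
  qed
qed

section \<open>Finite-dimensional laws of the series\<close>

definition schauder_index :: "nat \<Rightarrow> (nat \<times> nat) set" where
  "schauder_index N = insert (0, 0) ((\<lambda>(n, k). (Suc n, k)) ` (SIGMA n:{..<N}. {..<2^n}))"

lemma finite_schauder_index: "finite (schauder_index N)"
  by (simp add: schauder_index_def)

lemma sum_schauder_index:
  fixes f :: "nat \<times> nat \<Rightarrow> 'a::comm_monoid_add"
  shows "sum f (schauder_index N) = f (0, 0) + (\<Sum>n<N. \<Sum>k<2^n. f (Suc n, k))"
proof -
  have "inj_on (\<lambda>(n, k). (Suc n, k)) (SIGMA n:{..<N}. {..<(2::nat)^n})" by (auto simp: inj_on_def)
  then have "sum f ((\<lambda>(n, k). (Suc n, k)) ` (SIGMA n:{..<N}. {..<(2::nat)^n})) = (\<Sum>(n, k)\<in>(SIGMA n:{..<N}. {..<(2::nat)^n}). f (Suc n, k))"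
    by (simp add: sum.reindex o_def case_prod_beta')
  moreover have "(0, 0) \<notin> (\<lambda>(n, k). (Suc n, k)) ` (SIGMA n:{..<N}. {..<(2::nat)^n})" by auto
  ultimately show ?thesis
    unfolding schauder_index_def by (subst sum.insert) (auto simp: sum.Sigma)
qed

lemma AE_schauder_partial_sums_tendsto:
  "AE \<omega> in gaussian_sequence. (\<lambda>N. \<Sum>p\<in>schauder_index N. \<omega> p *\<^sub>R schauder p) \<longlonglongrightarrow> brownian \<omega>"
  using AE_summable_schauder_level
proof eventually_elim
  case (elim \<omega>)
  then have "(\<lambda>N. \<Sum>n<N. schauder_level n \<omega>) \<longlonglongrightarrow> (\<Sum>n. schauder_level n \<omega>)"
    by (rule summable_LIMSEQ)
  then show ?case
    unfolding sum_schauder_index brownian_def schauder_level_def by (intro tendsto_intros)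
qed

lemma sum_schauder_products:
  assumes "s \<in> {0..1}" "t \<in> {0..1}"
  shows "(\<Sum>p\<in>schauder_index N. eval (schauder p) s * eval (schauder p) t) = s * t + schauder_cov N s t"
proof -
  have "(1 / sqrt 2) ^ n * a * ((1 / sqrt 2) ^ n * b) = (1 / 2) ^ n * (a * b)" for n and a b :: real
  proof -
    have "(1 / sqrt 2) ^ n * (1 / sqrt 2) ^ n = (1 / 2 :: real) ^ n"
      by (simp add: power_mult_distrib[symmetric])
    then show ?thesis by (metis mult.assoc mult.commute)
  qed
  then show ?thesis
    unfolding sum_schauder_index eval_schauder[OF assms(1)] eval_schauder[OF assms(2)] schauder_cov_def
    by (simp only: sum_distrib_left)
qed

text \<open>Two limits of the same sequence are compared. For partial sums the integral is explicit
  by independence; it tends to the left side by dominated convergence, as the exponentials have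
  modulus 1, and to the right side by convergence of the covariances.\<close>

lemma char_brownian:
  assumes u: "u ` {..<k} \<subseteq> {0..1}"
  shows "(CLINT \<omega>|gaussian_sequence. iexp (\<Sum>i<k. a i * eval (brownian \<omega>) (u i)))
    = of_real (exp (- quad_form k (\<lambda>i j. min (u i) (u j)) a / 2))"
proof (rule LIMSEQ_unique)
  define S where "S N \<omega> = (\<Sum>p\<in>schauder_index N. \<omega> p *\<^sub>R schauder p)" for N and \<omega> :: "nat \<times> nat \<Rightarrow> real"
  have [measurable]: "(\<lambda>\<omega>. eval (brownian \<omega>) s) \<in> borel_measurable gaussian_sequence" for s
    by (rule measurable_compose[OF measurable_brownian borel_measurable_eval])
  have [measurable]: "(\<lambda>\<omega>. eval (S N \<omega>) s) \<in> borel_measurable gaussian_sequence" for N s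
    unfolding S_def eval_sum eval_scaleR
    by (intro borel_measurable_sum borel_measurable_times gaussian_coordinate_measurable borel_measurable_const)
  show "(\<lambda>N. CLINT \<omega>|gaussian_sequence. iexp (\<Sum>i<k. a i * eval (S N \<omega>) (u i)))
    \<longlonglongrightarrow> (CLINT \<omega>|gaussian_sequence. iexp (\<Sum>i<k. a i * eval (brownian \<omega>) (u i)))"
  proof (rule integral_dominated_convergence[where w = "\<lambda>_. 1"])
    show "AE \<omega> in gaussian_sequence. (\<lambda>N. iexp (\<Sum>i<k. a i * eval (S N \<omega>) (u i)))
      \<longlonglongrightarrow> iexp (\<Sum>i<k. a i * eval (brownian \<omega>) (u i))"
      using AE_schauder_partial_sums_tendsto
      unfolding S_def[symmetric]
      by eventually_elim (intro tendsto_intros bounded_linear.tendsto[OF bounded_linear_eval])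
  qed auto
  have "(CLINT \<omega>|gaussian_sequence. iexp (\<Sum>i<k. a i * eval (S N \<omega>) (u i)))
    = of_real (exp (- quad_form k (\<lambda>i j. u i * u j + schauder_cov N (u i) (u j)) a / 2))" for N
  proof -
    let ?c = "\<lambda>p. \<Sum>i<k. a i * eval (schauder p) (u i)"
    \<comment> \<open>Regrouped by index \<open>p\<close>, the combination of values of the path
      becomes a combination of independent standard normal variables with coefficients
      \<open>?c p\<close>.\<close>
    have "(\<Sum>i<k. a i * eval (S N \<omega>) (u i)) = (\<Sum>p\<in>schauder_index N. ?c p * \<omega> p)" for \<omega>
      unfolding S_def eval_sum eval_scaleR sum_distrib_left sum_distrib_right
      by (subst sum.swap) (simp add: algebra_simps)
    then have "(CLINT \<omega>|gaussian_sequence. iexp (\<Sum>i<k. a i * eval (S N \<omega>) (u i)))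
      = of_real (exp (- (\<Sum>p\<in>schauder_index N. (?c p)\<^sup>2) / 2))"
      using char_gaussian_sum[OF finite_schauder_index, of ?c N] by simp
    also have "(\<Sum>p\<in>schauder_index N. (?c p)\<^sup>2)
      = (\<Sum>p\<in>schauder_index N. \<Sum>i<k. \<Sum>j<k. a i * a j * (eval (schauder p) (u i) * eval (schauder p) (u j)))"
      by (simp add: power2_eq_square sum_product algebra_simps)
    also have "\<dots> = (\<Sum>i<k. \<Sum>j<k. \<Sum>p\<in>schauder_index N. a i * a j * (eval (schauder p) (u i) * eval (schauder p) (u j)))"
      by (subst sum.swap, rule sum.cong[OF refl], rule sum.swap)
    also have "\<dots> = quad_form k (\<lambda>i j. u i * u j + schauder_cov N (u i) (u j)) a"
      unfolding quad_form_def sum_distrib_left[symmetric] using u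
      by (intro sum.cong refl arg_cong2[where f = "(*)"] sum_schauder_products) auto
    finally show ?thesis .
  qed
  moreover have "(\<lambda>N. quad_form k (\<lambda>i j. u i * u j + schauder_cov N (u i) (u j)) a) \<longlonglongrightarrow> quad_form k (\<lambda>i j. min (u i) (u j)) a"
    unfolding quad_form_def using u by (intro tendsto_sum tendsto_mult_left schauder_cov_tendsto) auto
  ultimately show "(\<lambda>N. CLINT \<omega>|gaussian_sequence. iexp (\<Sum>i<k. a i * eval (S N \<omega>) (u i)))
    \<longlonglongrightarrow> of_real (exp (- quad_form k (\<lambda>i j. min (u i) (u j)) a / 2))"
    by (auto intro!: tendsto_intros)
qed

lemma wiener_distr_brownian: "is_wiener_measure (distr gaussian_sequence borel brownian)"
  unfolding is_wiener_measure_def brownian_marginals_def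
proof (intro conjI allI impI)
  let ?W = "distr gaussian_sequence borel brownian"
  show "prob_space ?W" by (rule gaussian.prob_space_distr) measurable
  interpret W: prob_space ?W by fact
  fix p and u :: "nat \<Rightarrow> real"
  assume u: "u ` {..<p} \<subseteq> {0..1}"
  have pi: "\<pi> p u \<in> ?W \<rightarrow>\<^sub>M borel_vec p"
    using measurable_pi by (simp cong: measurable_cong_sets)
  show "multivariate_normal p (\<lambda>_. 0) (\<lambda>j r. min (u j) (u r)) (distr ?W (borel_vec p) (\<pi> p u))"
  proof (rule multivariate_normalI)
    show "prob_space (distr ?W (borel_vec p) (\<pi> p u))" by (rule W.prob_space_distr) (rule pi)
    fix a
    have meas: "(\<lambda>y. iexp (\<Sum>i<p. a i * y i)) \<in> borel_measurable (borel_vec p)" by measurable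
    have "(CLINT y|distr ?W (borel_vec p) (\<pi> p u). iexp (\<Sum>i<p. a i * y i))
      = (CLINT x|?W. iexp (\<Sum>i<p. a i * \<pi> p u x i))"
      by (rule integral_distr[OF pi meas])
    also have "\<dots> = (CLINT \<omega>|gaussian_sequence. iexp (\<Sum>i<p. a i * \<pi> p u (brownian \<omega>) i))"
      by (rule integral_distr) (auto intro!: measurable_compose[OF measurable_pi meas])
    also have "\<dots> = (CLINT \<omega>|gaussian_sequence. iexp (\<Sum>i<p. a i * eval (brownian \<omega>) (u i)))"
      by (simp add: \<pi>_def)
    finally show "(CLINT y|distr ?W (borel_vec p) (\<pi> p u). iexp (\<Sum>i<p. a i * y i))
      = of_real (exp (- quad_form p (\<lambda>j r. min (u j) (u r)) a / 2))"
      unfolding char_brownian[OF u] .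
  qed (auto simp: min.commute)
qed simp

theorem mainTheorem2:
  fixes t :: "nat \<Rightarrow> real"
  assumes "inj t" and "range t \<subseteq> {0<..1}" and "{0..1} \<subseteq> closure (range t)"
  shows "measure_space UNIV (sets borel) (\<lambda>A. ennreal (\<mu> t A)) \<and>
    (\<forall>p u. u ` {..<p} \<subseteq> {0..1} \<longrightarrow>
      multivariate_normal p (\<lambda>_. 0) (\<lambda>j r. min (u j) (u r))
        (distr (\<mu>_measure t) (borel_vec p) (\<pi> p u))) \<and>
    is_wiener_measure (\<mu>_measure t) \<and>
    (\<forall>W. is_wiener_measure W \<longrightarrow> W = \<mu>_measure t)"
proof -
  have t: "range t \<subseteq> {0..1}" using assms(2) by (auto simp: subset_iff less_imp_le)
  \<comment> \<open>Used for the constructed Wiener measure this shows that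
    \<open>\<mu>_measure t\<close> is one; used for an arbitrary one it gives uniqueness.\<close>
  have eq: "measure_space UNIV (sets borel) (\<lambda>A. ennreal (\<mu> t A)) \<and> \<mu>_measure t = W"
    if "is_wiener_measure W" for W
    using wiener.mu_measure_eq[OF wiener.intro[OF that] t assms(3)] by simp
  have W: "is_wiener_measure (\<mu>_measure t)"
    using eq[OF wiener_distr_brownian] wiener_distr_brownian by simp
  then show ?thesis
    using eq eq[OF W] unfolding is_wiener_measure_def brownian_marginals_def by blast
qed

end
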